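(* For every integer $n\ge 1$, the inverse Kazhdan--Lusztig polynomial of the fan graph $F_n$ (i.e. of the fan matroid $\mathsf{M}(F_n)$) is $$Q_{F_n}(t)=\sum_{k=0}^{\lfloor (n-1)/2\rfloor}\frac{(n-2k)\,2^{\,n-2k-1}}{n}\binom{n}{k}\,t^{k}.$$
   Context: All graphs are finite and loopless (parallel edges allowed). For a graph $G$, $\mathsf{M}(G)$ is its graphic matroid, $c(G)$ its number of connected components, and $\mathrm{rk}(G)=|V(G)|-c(G)$ its rank. A composition of $G$ is a partition of $V(G)$ into vertex sets of connected induced subgraphs; $\mathcal{C}(G)$ is the set of compositions and $|C|$ is the number of parts of $C$. Compositions correspond bijectively to flats of $\mathsf{M}(G)$: $C$ corresponds to the set of edges with both endpoints in a common part of $C$. For $C\in\mathcal{C}(G)$, $G[C]$ is the subgraph whose edge set is that flat and whose vertices are the endpoints of these edges, with $\mathrm{rk}(G[C])=|V(G)|-|C|$, and $G/C$ is the graph obtained from $G$ by contracting all edges of that flat (its vertices are the parts of $C$). $\chi_G(t)$ is the chromatic polynomial of $G$. The inverse Kazhdan--Lusztig polynomials $Q_G(t)\in\mathbb{Z}[t]$ are uniquely determined by: (i) if $\mathrm{rk}(G)=0$ then $Q_G(t)=1$; (ii) if $\mathrm{rk}(G)>0$ then $\deg Q_G(t)<\frac12\mathrm{rk}(G)$ and $$(-t)^{\mathrm{rk}(G)}Q_G(t^{-1})=\sum_{C\in\mathcal{C}(G)}(-1)^{\mathrm{rk}(G[C])}Q_{G[C]}(t)\cdot t^{|C|}\chi_{G/C}(t^{-1}).$$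 For $n\ge1$ the fan graph $F_n$ is the graph on vertices $0,1,\dots,n$ obtained from the path $1,2,\dots,n$ by joining vertex $0$ to every vertex of the path. *)

theory Defs
  imports Complex_Main "HOL-Library.Disjoint_Sets" "HOL-Library.FuncSet"
    "HOL-Computational_Algebra.Polynomial"
begin

text \<open>Undirected multigraphs: every edge is a name carrying its set of end vertices, so parallel
  edges are distinct names with the same ends.\<close>

record ('v, 'e) mgraph =
  verts :: "'v set"
  edges :: "'e set"
  ends :: "'e \<Rightarrow> 'v set"

definition finite_loopless :: "('v, 'e) mgraph \<Rightarrow> bool" where
  "finite_loopless G \<longleftrightarrow> finite (verts G) \<and> finite (edges G) \<and>
     (\<forall>e\<in>edges G. ends G e \<subseteq> verts G \<and> card (ends G e) = 2)"

definition adj :: "('v, 'e) mgraph \<Rightarrow> 'v rel" where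
  "adj G = {(u, v). \<exists>e\<in>edges G. ends G e = {u, v}}"

definition connected_graph :: "('v, 'e) mgraph \<Rightarrow> bool" where
  "connected_graph G \<longleftrightarrow> verts G \<noteq> {} \<and> (\<forall>u\<in>verts G. \<forall>v\<in>verts G. (u, v) \<in> (adj G)\<^sup>*)"

definition components :: "('v, 'e) mgraph \<Rightarrow> 'v set set" where
  "components G = verts G // {(u, v). u \<in> verts G \<and> v \<in> verts G \<and> (u, v) \<in> (adj G)\<^sup>*}"

definition rk :: "('v, 'e) mgraph \<Rightarrow> nat" where
  "rk G = card (verts G) - card (components G)"

definition induced :: "('v, 'e) mgraph \<Rightarrow> 'v set \<Rightarrow> ('v, 'e) mgraph" where
  "induced G S = G\<lparr>verts := S, edges := {e\<in>edges G. ends G e \<subseteq> S}\<rparr>"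

definition compositions :: "('v, 'e) mgraph \<Rightarrow> 'v set set set" where
  "compositions G = {C. partition_on (verts G) C \<and> (\<forall>P\<in>C. connected_graph (induced G P))}"

definition flat :: "('v, 'e) mgraph \<Rightarrow> 'v set set \<Rightarrow> 'e set" where
  "flat G C = {e\<in>edges G. \<exists>P\<in>C. ends G e \<subseteq> P}"

text \<open>The graph $G[C]$; note that vertices not incident with the flat are discarded.\<close>

definition restrict_comp :: "('v, 'e) mgraph \<Rightarrow> 'v set set \<Rightarrow> ('v, 'e) mgraph" where
  "restrict_comp G C = G\<lparr>verts := (\<Union>e\<in>flat G C. ends G e), edges := flat G C\<rparr>"

text \<open>The graph $G/C$; parallel edges arising from the contraction are kept.\<close>

definition contract_comp :: "('v, 'e) mgraph \<Rightarrow> 'v set set \<Rightarrow> ('v set, 'e) mgraph" where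
  "contract_comp G C =
     \<lparr>verts = C, edges = edges G - flat G C, ends = (\<lambda>e. {P\<in>C. P \<inter> ends G e \<noteq> {}})\<rparr>"

definition proper_colourings :: "('v, 'e) mgraph \<Rightarrow> nat \<Rightarrow> ('v \<Rightarrow> nat) set" where
  "proper_colourings G k =
     {f \<in> verts G \<rightarrow>\<^sub>E {..<k}. \<forall>e\<in>edges G. \<forall>u v. ends G e = {u, v} \<longrightarrow> f u \<noteq> f v}"

definition chromatic_poly :: "('v, 'e) mgraph \<Rightarrow> int poly" where
  "chromatic_poly G =
     (THE p. \<forall>k. poly p (int k) = int (card (proper_colourings G k)))"

text \<open>The defining conditions of the inverse Kazhdan--Lusztig polynomials for the graph \<open>G\<close>, as a
  property of a family \<open>Q\<close> of polynomials indexed by graphs. The identity of Laurent polynomials is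
  expressed by evaluation at every nonzero real number.\<close>

definition inverse_KL_conditions ::
    "(('v, 'e) mgraph \<Rightarrow> int poly) \<Rightarrow> ('v, 'e) mgraph \<Rightarrow> bool" where
  "inverse_KL_conditions Q G \<longleftrightarrow>
     (rk G = 0 \<longrightarrow> Q G = 1) \<and>
     (rk G > 0 \<longrightarrow>
        real (degree (Q G)) < real (rk G) / 2 \<and>
        (\<forall>t::real. t \<noteq> 0 \<longrightarrow>
           (- t) ^ rk G * poly (map_poly of_int (Q G)) (1 / t) =
           (\<Sum>C\<in>compositions G.
              (- 1) ^ rk (restrict_comp G C) * poly (map_poly of_int (Q (restrict_comp G C))) t *
              (t ^ card C * poly (map_poly of_int (chromatic_poly (contract_comp G C))) (1 / t)))))"

lemma inverse_KL_conditions_cong [fundef_cong]: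
  assumes "G = G'" and "Q G' = Q' G'"
    and "\<And>C. C \<in> compositions G' \<Longrightarrow> Q (restrict_comp G' C) = Q' (restrict_comp G' C)"
  shows "inverse_KL_conditions Q G = inverse_KL_conditions Q' G'"
  using assms unfolding inverse_KL_conditions_def by (simp cong: sum.cong)

lemma restrict_comp_smaller:
  assumes "finite_loopless G" and "restrict_comp G C \<noteq> G"
  shows "card (verts (restrict_comp G C)) + card (edges (restrict_comp G C))
           < card (verts G) + card (edges G)"
proof -
  let ?V = "verts (restrict_comp G C)" and ?E = "edges (restrict_comp G C)"
  have fin: "finite (verts G)" "finite (edges G)"
    and V: "?V \<subseteq> verts G" and E: "?E \<subseteq> edges G"
    using assms(1) by (auto simp: finite_loopless_def restrict_comp_def flat_def)
  have "?V \<noteq> verts G \<or> ?E \<noteq> edges G"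
    using assms(2) by (cases G) (auto simp: restrict_comp_def)
  then have "card ?V < card (verts G) \<or> card ?E < card (edges G)"
    using V E fin by (meson psubsetI psubset_card_mono)
  moreover have "card ?V \<le> card (verts G)" "card ?E \<le> card (edges G)"
    using V E fin by (simp_all add: card_mono)
  ultimately show ?thesis by linarith
qed

text \<open>The family satisfying the conditions, by recursion on the size of the graph. When \<open>C\<close>
  consists of the components of a graph \<open>G\<close> without isolated vertices, $G[C]$ is \<open>G\<close> itself, so
  \<open>Q G\<close> occurs on both sides of the recursion and is determined implicitly. Any family
  satisfying the conditions agrees with this one (\<open>inverse_KL_unique\<close> below). Outside finite
  loopless graphs the value is a dummy.\<close>

function inverse_KL :: "('v, 'e) mgraph \<Rightarrow> int poly" where
  "inverse_KL G =
     (if finite_loopless G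
      then THE q. inverse_KL_conditions (\<lambda>H. if H = G then q else inverse_KL H) G
      else 0)"
  by auto

termination
  by (relation "Wellfounded.measure (\<lambda>G. card (verts G) + card (edges G))")
    (auto intro: restrict_comp_smaller)

declare inverse_KL.simps [simp del]

lemma composition_refines:
  assumes "C \<in> compositions G" "D \<in> compositions G" "restrict_comp G D = G" "P \<in> C"
  shows "\<exists>R\<in>D. P \<subseteq> R"
proof -
  have fl: "flat G D = edges G"
    using arg_cong[OF assms(3), of edges] by (simp add: restrict_comp_def)
  have pC: "partition_on (verts G) C" and pD: "partition_on (verts G) D"
    and con: "connected_graph (induced G P)"
    using assms by (auto simp: compositions_def)
  obtain u where u: "u \<in> P" using con by (auto simp: connected_graph_def induced_def)
  then have "u \<in> verts G" using pC assms(4) by (auto simp: partition_on_def)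
  then obtain R where R: "R \<in> D" "u \<in> R" using pD by (auto simp: partition_on_def)
  have "v \<in> R" if "(u, v) \<in> (adj (induced G P))\<^sup>*" for v
    using that
  proof induction
    case (step v w)
    then obtain e where "e \<in> edges G" "ends G e = {v, w}"
      by (auto simp: adj_def induced_def)
    then have "e \<in> flat G D" using fl by simp
    then obtain R' where "R' \<in> D" "{v, w} \<subseteq> R'" using \<open>ends G e = {v, w}\<close> by (auto simp: flat_def)
    with step R(1) pD show ?case by (auto simp: partition_on_def disjoint_def)
  qed (use R in simp)
  then have "P \<subseteq> R" using con u by (auto simp: connected_graph_def induced_def)
  with R show ?thesis by blast
qed

lemma top_composition_unique:
  assumes "C \<in> compositions G" "D \<in> compositions G"
    and "restrict_comp G C = G" "restrict_comp G D = G"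
  shows "C = D"
proof -
  have "A \<subseteq> B" if *: "A \<in> compositions G" "B \<in> compositions G"
      "restrict_comp G A = G" "restrict_comp G B = G" for A B
  proof
    fix P assume P: "P \<in> A"
    obtain R where R: "R \<in> B" "P \<subseteq> R" using composition_refines[OF *(1,2,4) P] by blast
    obtain P' where P': "P' \<in> A" "R \<subseteq> P'" using composition_refines[OF *(2,1,3) R(1)] by blast
    have "partition_on (verts G) A" using *(1) by (simp add: compositions_def)
    then have "P \<noteq> {}" "P \<inter> P' = {} \<or> P = P'"
      using P P' unfolding partition_on_def disjoint_def by metis+
    with P' R have "P = P'" by blast
    with P' R show "P \<in> B" by auto
  qed
  from this[OF assms] this[OF assms(2,1,4,3)] show ?thesis by blast
qed

lemma chromatic_poly_eqI:
  assumes "\<And>k. poly p (int k) = int (card (proper_colourings G k))"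
  shows "chromatic_poly G = p"
  unfolding chromatic_poly_def
proof (rule the_equality)
  fix q assume "\<forall>k. poly q (int k) = int (card (proper_colourings G k))"
  then have "range int \<subseteq> {x. poly (q - p) x = 0}" using assms by auto
  moreover have "infinite (range int)" by (simp add: range_inj_infinite)
  ultimately have "infinite {x. poly (q - p) x = 0}" using finite_subset by blast
  then have "q - p = 0" using poly_roots_finite by blast
  then show "q = p" by simp
qed (use assms in blast)

lemma chromatic_poly_top:
  assumes "finite C" "restrict_comp G C = G"
  shows "chromatic_poly (contract_comp G C) = monom 1 (card C)"
proof (rule chromatic_poly_eqI)
  fix k
  have "flat G C = edges G"
    using arg_cong[OF assms(2), of edges] by (simp add: restrict_comp_def)
  then have "proper_colourings (contract_comp G C) k = C \<rightarrow>\<^sub>E {..<k}"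
    by (simp add: proper_colourings_def contract_comp_def)
  then show "poly (monom 1 (card C)) (int k)
      = int (card (proper_colourings (contract_comp G C) k))"
    using assms(1) by (simp add: poly_monom card_PiE)
qed

lemma reflect_eq_multiple_imp_0:
  fixes d :: "real poly"
  assumes "2 * degree d < r" and eq: "\<And>t. t \<noteq> 0 \<Longrightarrow> t ^ r * poly d (1 / t) = m * poly d t"
  shows "d = 0"
proof -
  let ?L = "monom 1 (r - degree d) * reflect_poly d"
  have "poly (?L - smult m d) t = 0" if "t \<noteq> 0" for t
  proof -
    have "t ^ r = t ^ (r - degree d) * t ^ degree d"
      using assms(1) by (simp flip: power_add)
    then show ?thesis using eq[OF that] that
      by (simp add: poly_monom poly_reflect_poly_nz inverse_eq_divide)
  qed
  then have "- {0} \<subseteq> {t. poly (?L - smult m d) t = 0}" by auto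
  moreover have "infinite (- {0::real})" by (simp add: infinite_UNIV_char_0 finite_compl)
  ultimately have "infinite {t. poly (?L - smult m d) t = 0}" using finite_subset by blast
  then have "?L - smult m d = 0" using poly_roots_finite by blast
  then have L: "?L = smult m d" by simp
  have "coeff (smult m d) i = 0" for i
  proof (cases "i \<le> degree d")
    case True
    then have "coeff ?L i = 0" using assms(1) by (simp add: coeff_monom_mult)
    then show ?thesis using L by simp
  qed (simp add: coeff_eq_0)
  then have "?L = 0" using L by (simp add: poly_eq_iff)
  then show ?thesis by simp
qed

lemma inverse_KL_conditions_unique:
  fixes G :: "('v, 'e) mgraph"
  assumes G: "finite_loopless G"
    and p: "inverse_KL_conditions (Q(G := p)) G" and q: "inverse_KL_conditions (Q(G := q)) G"
  shows "p = q"
proof (cases "rk G = 0")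
  case False
  define T where "T = {C \<in> compositions G. restrict_comp G C = G}"
  define P where "P p = (map_poly of_int p :: real poly)" for p
  define S where "S p C t = (- 1) ^ rk (restrict_comp G C) * poly (P ((Q(G := p)) (restrict_comp G C))) t *
              (t ^ card C * poly (P (chromatic_poly (contract_comp G C))) (1 / t))" for p C t
  have fin: "finite (compositions G)"
  proof (rule finite_subset)
    show "compositions G \<subseteq> Pow (Pow (verts G))"
      by (auto simp: compositions_def dest: partition_onD1)
    show "finite (Pow (Pow (verts G)))" using G by (simp add: finite_loopless_def)
  qed
  have eq: "(- t) ^ rk G * poly (P x) (1 / t) = (\<Sum>C\<in>compositions G. S x C t)"
    if "t \<noteq> 0" "inverse_KL_conditions (Q(G := x)) G" for x t
    using that False by (simp add: inverse_KL_conditions_def S_def P_def)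
  have diff: "S p C t - S q C t = (if C \<in> T then (- 1) ^ rk G * poly (P p - P q) t else 0)"
    if "t \<noteq> 0" "C \<in> compositions G" for C t
  proof (cases "restrict_comp G C = G")
    case True
    have "finite C" using that(2) G
      by (auto simp: compositions_def finite_loopless_def intro: finite_elements)
    then have "P (chromatic_poly (contract_comp G C)) = monom 1 (card C)"
      using chromatic_poly_top[OF _ True] by (simp add: P_def map_poly_monom)
    then show ?thesis using that True
      by (simp add: S_def T_def poly_monom power_divide algebra_simps)
  qed (simp add: S_def T_def)
  have "P p - P q = 0"
  proof (rule reflect_eq_multiple_imp_0[where r = "rk G" and m = "real (card T)"])
    have "2 * degree p < rk G" "2 * degree q < rk G"
      using p q False by (auto simp: inverse_KL_conditions_def)
    then show "2 * degree (P p - P q) < rk G"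
      using degree_diff_le_max[of "P p" "P q"] by (simp add: P_def degree_map_poly)
    fix t :: real assume t: "t \<noteq> 0"
    have "(- t) ^ rk G * poly (P p - P q) (1 / t) = (\<Sum>C\<in>compositions G. S p C t - S q C t)"
      using eq[OF t p] eq[OF t q] by (simp add: algebra_simps sum_subtractf)
    also have "\<dots> = (\<Sum>C\<in>compositions G. if C \<in> T then (- 1) ^ rk G * poly (P p - P q) t else 0)"
      using diff[OF t] by simp
    also have "\<dots> = real (card T) * ((- 1) ^ rk G * poly (P p - P q) t)"
      using fin by (simp add: T_def sum.If_cases Int_def conj_commute)
    finally have "(- 1) ^ rk G * (t ^ rk G * poly (P p - P q) (1 / t)) = 
        (- 1) ^ rk G * (real (card T) * poly (P p - P q) t)"
      by (subst (asm) power_minus) (simp add: mult_ac)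
    then show "t ^ rk G * poly (P p - P q) (1 / t) = real (card T) * poly (P p - P q) t"
      by (simp only: mult_cancel_left) simp
  qed
  then show ?thesis by (simp add: P_def poly_eq_iff coeff_map_poly)
qed (use p q in \<open>simp add: inverse_KL_conditions_def\<close>)

lemma inverse_KL_unique:
  fixes Q :: "('v, 'e) mgraph \<Rightarrow> int poly"
  assumes Q: "\<And>H. finite_loopless H \<Longrightarrow> inverse_KL_conditions Q H" and "finite_loopless G"
  shows "inverse_KL G = Q G"
  using assms(2)
proof (induction "card (verts G) + card (edges G)" arbitrary: G rule: less_induct)
  case less
  have fl: "finite_loopless (restrict_comp G C)" for C
    using less.prems
    by (auto simp: finite_loopless_def restrict_comp_def flat_def intro: card_ge_0_finite)
  have eq: "inverse_KL_conditions (\<lambda>H. if H = G then q else inverse_KL H) G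
      = inverse_KL_conditions (Q(G := q)) G" for q
    using less fl restrict_comp_smaller by (intro inverse_KL_conditions_cong) auto
  have Qself: "inverse_KL_conditions (Q(G := Q G)) G" using Q less.prems by simp
  have "(THE q. inverse_KL_conditions (Q(G := q)) G) = Q G"
    using Qself inverse_KL_conditions_unique[OF less.prems] by blast
  then show ?case using less.prems by (subst inverse_KL.simps) (simp add: eq)
qed

definition fan :: "nat \<Rightarrow> (nat, nat set) mgraph" where
  "fan n = \<lparr>verts = {0..n},
     edges = {{i, Suc i} | i. 1 \<le> i \<and> i < n} \<union> {{0, i} | i. 1 \<le> i \<and> i \<le> n},
     ends = (\<lambda>e. e)\<rparr>"

end

theory Submission
  imports Defs "HOL-Computational_Algebra.Formal_Power_Series"
begin

text \<open>
  The idea is to read the defining identity at \<open>t = 1/k\<close> for a positive integer \<open>k\<close>. A composition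
  \<open>C\<close> of \<open>G\<close> together with a proper colouring of \<open>G/C\<close> with \<open>k\<close> colours is the same thing as an
  arbitrary colouring of the vertices of \<open>G\<close> whose monochromatic edges are exactly the flat of \<open>C\<close>.
  The right-hand side is therefore one sum over all colourings of \<open>G\<close>
  (\<open>sum_compositions_eq_sum_colourings\<close>), and neither the lattice of flats nor a chromatic polynomial
  ever has to be determined. Both sides are Laurent polynomials in \<open>t\<close>, so the infinitely many values
  \<open>1/k\<close> suffice.

  The recursion for the fan \<open>F\<^sub>n\<close> runs through its flats, that is, through the edge sets that do not
  contain exactly two edges of a triangle. Read the rim vertices \<open>1, \<dots>, n\<close> of such a subgraph
  from left to right: a maximal run of \<open>m\<close> vertices joined to the hub \<open>0\<close> spans a copy of \<open>F\<^sub>m\<close>, and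
  all other edges are bridges. The candidate for its inverse Kazhdan--Lusztig polynomial is the product
  of the polynomials \<open>q\<^sub>m\<close> of the theorem over the runs. This family satisfies the defining conditions
  on all flats of \<open>F\<^sub>n\<close> (\<open>inverse_KL_conditions_fan_family\<close>), and a family that does so on a class of
  graphs closed under passing to flats is the inverse Kazhdan--Lusztig family there
  (\<open>inverse_KL_eqI\<close>).

  For the conditions, the sum over colourings is a sum over words in the colours of the rim vertices.
  It splits into one factor for each bridge, which is immediate, and one factor for each run
  (\<open>word_sum_run_product\<close>). The factor of a run is governed by a linear recursion: a word either
  continues with the colour of the hub or with another colour, and a stretch of \<open>g\<close> vertices in other
  colours contributes \<open>(k - 1) (-2)\<^sup>g\<^sup>-\<^sup>1\<close>. What remains is an identity between the \<open>q\<^sub>m\<close> and their reversals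
  (\<open>hub_sum_fan_poly\<close>). Let \<open>w\<close> be the power series with \<open>w = -X (1 + k w\<^sup>2)\<close>, that is,
  \<open>w = -X c(k X\<^sup>2)\<close> for the Catalan series \<open>c\<close>. Then
  \<open>\<Sum>\<^sub>n (-1)\<^sup>n q\<^sub>n(k) X\<^sup>n = (1 - w) / (1 - 2 w)\<close> and \<open>\<Sum>\<^sub>n (-k)\<^sup>n q\<^sub>n(1/k) X\<^sup>n = (1 - k w) / (1 - 2 k w)\<close>,
  because the coefficients of the powers of \<open>w\<close> are, up to signs and powers of \<open>k\<close>, the ballot numbers
  \<open>(n - 2 i)/n \<cdot> (n choose i)\<close>; and since \<open>X = -w / (1 + k w\<^sup>2)\<close>, the identity becomes one between rational functions of \<open>w\<close>.
\<close>

unbundle fps_syntax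

section \<open>Ballot numbers and powers of the Catalan series\<close>

text \<open>The ballot number \<open>(n - 2 i)/n \<cdot> (n choose i)\<close> for \<open>2 i \<le> n\<close>, \<open>n > 0\<close>, in a form that is visibly an
  integer and has the value \<open>1\<close> at \<open>n = i = 0\<close>.\<close>

definition ballot :: "nat \<Rightarrow> nat \<Rightarrow> int" where
  "ballot n i = 2 * int ((n - 1) choose i) - int (n choose i)"

text \<open>The value \<open>1\<close> for \<open>n = 0\<close> is the convention that lets runs of length \<open>0\<close> be ignored in products.\<close>

definition fan_poly :: "nat \<Rightarrow> int poly" where
  "fan_poly n = (if n = 0 then 1
     else \<Sum>i = 0..(n - 1) div 2. monom (2 ^ (n - 2 * i - 1) * ballot n i) i)"

abbreviation real_poly :: "int poly \<Rightarrow> real poly" where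
  "real_poly \<equiv> map_poly of_int"

lemma of_nat_mult_ballot:
  assumes "2 * i \<le> n"
  shows "real n * of_int (ballot n i) = real (n - 2 * i) * real (n choose i)"
proof -
  have "real (n * ((n - 1) choose i)) = real ((n - i) * (n choose i))"
    by (simp only: binomial_absorb_comp)
  then show ?thesis
    using assms by (simp add: ballot_def algebra_simps of_nat_diff)
qed

lemma ballot_pascal:
  assumes "n \<ge> 1"
  shows "ballot (Suc n) (Suc i) = ballot n (Suc i) + ballot n i"
  using assms by (cases n) (auto simp: ballot_def)

lemma ballot_0 [simp]: "ballot n 0 = 1"
  by (simp add: ballot_def)

lemma ballot_half: 
  assumes "i \<ge> 1" shows "ballot (2 * i) i = 0"
proof -
  have "real (2 * i) * of_int (ballot (2 * i) i) = 0"
    using of_nat_mult_ballot[of i "2 * i"] by simp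
  then show ?thesis using assms by simp
qed

text \<open>Multiplying \<open>w = -X (1 + k w\<^sup>2)\<close> by a power of \<open>w\<close> expresses a coefficient of \<open>w\<^sup>j\<close> by the preceding
  coefficients of \<open>w\<^sup>j\<^sup>-\<^sup>1\<close> and \<open>w\<^sup>j\<^sup>+\<^sup>1\<close>; up to signs and powers of \<open>k\<close> this is the Pascal recursion of the
  ballot numbers. The boundary case \<open>j = 0\<close> agrees because \<open>ballot (2 * i) i\<close> vanishes.\<close>

lemma power_nth_eq_ballot:
  fixes w :: "real fps"
  assumes w: "w = - fps_X * (1 + fps_const k * w\<^sup>2)"
  shows "(w ^ j) $ n = (if j \<le> n \<and> even (n - j)
     then (- 1) ^ n * k ^ ((n - j) div 2) * of_int (ballot n ((n - j) div 2)) else 0)"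
proof (induction n arbitrary: j)
  case 0
  have "w $ 0 = 0" by (subst w) simp
  then show ?case by (cases "j = 0") (auto simp: fps_nth_power_0)
next
  case (Suc n)
  show ?case
  proof (cases j)
    case 0
    then show ?thesis
      using ballot_half[of "Suc n div 2"] by (cases "even (Suc n)") (auto elim!: evenE)
  next
    case (Suc j')
    have "w ^ j = - (fps_X * (w ^ j' + fps_const k * w ^ (j' + 2)))"
      unfolding Suc power_Suc2 by (subst (2) w) (simp add: algebra_simps power2_eq_square)
    then have *: "(w ^ j) $ Suc n = - ((w ^ j') $ n + k * (w ^ (j' + 2)) $ n)"
      by simp
    have "n < j' \<or> n = j' \<or> n = Suc j' \<or> (\<exists>i. n = j' + 2 * Suc i) \<or> (\<exists>i. n = j' + 2 * Suc i + 1)"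
      by presburger
    then consider "n < j'" | "n = j'" | "n = Suc j'" | i where "n = j' + 2 * Suc i" | i where "n = j' + 2 * Suc i + 1"
      by blast
    then show ?thesis
    proof cases
      case (4 i)
      have e: "Suc n - j = 2 * Suc i" "n - j' = 2 * Suc i" "n - (j' + 2) = 2 * i" "j' + 2 \<le> n" "j \<le> Suc n" "j' \<le> n"
        using 4 Suc by auto
      have "n \<ge> 1" using 4 by auto
      then show ?thesis unfolding * Suc.IH e
        using e(4-6) by (simp add: ballot_pascal algebra_simps)
    next
      case (5 i)
      have e: "Suc n - j = Suc (2 * Suc i)" "n - j' = Suc (2 * Suc i)" "n - (j' + 2) = Suc (2 * i)"
        using 5 Suc by auto
      show ?thesis unfolding * Suc.IH e by simp
    qed (unfold *, unfold Suc.IH Suc, auto)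
  qed
qed

text \<open>The series \<open>w\<close> is the compositional inverse of \<open>-X / (1 + k X\<^sup>2)\<close>.\<close>

lemma ex_inverse_series:
  "\<exists>w :: real fps. w = - fps_X * (1 + fps_const k * w\<^sup>2)"
proof -
  define d :: "real fps" where "d = 1 + fps_const k * fps_X\<^sup>2"
  define a where "a = - fps_X * inverse d"
  have d0: "d $ 0 = 1" by (simp add: d_def)
  have da: "a * d = - fps_X" 
    using d0 by (simp add: a_def mult.assoc inverse_mult_eq_1)
  have a0: "a $ 0 = 0" "a $ 1 \<noteq> 0" by (simp_all add: a_def d0)
  define w where "w = fps_inv a"
  have w0: "w $ 0 = 0" by (simp add: w_def fps_inv_def)
  have "(a * d) oo w = - w" using w0 by (simp add: da fps_compose_uminus)
  moreover have "(a * d) oo w = fps_X * (1 + fps_const k * w\<^sup>2)"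
    using w0 a0 by (simp add: fps_compose_mult_distrib w_def fps_inv_right d_def fps_compose_add_distrib power2_eq_square)
  ultimately show ?thesis by (metis minus_minus minus_mult_left)
qed

text \<open>The expansion of \<open>(1 - X) / (1 - 2 X)\<close>. Substituting \<open>w\<close> and \<open>k w\<close> for \<open>X\<close> gives the generating
  functions of the fan polynomials and of their reversals.\<close>

definition geo :: "real fps" where "geo = Abs_fps (\<lambda>j. if j = 0 then 1 else 2 ^ (j - 1))"

lemma geo_mult: "(1 - 2 * fps_X) * geo = 1 - fps_X"
proof -
  have "((1 - 2 * fps_X) * geo) $ n = (1 - fps_X :: real fps) $ n" for n
  proof (cases n)
    case (Suc m)
    then show ?thesis by (cases m) (simp_all add: geo_def algebra_simps numeral_fps_const)
  qed (simp add: geo_def)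
  then show ?thesis by (simp add: fps_eq_iff)
qed

lemma geo_compose_mult:
  assumes "w $ 0 = 0"
  shows "(1 - 2 * w) * (geo oo w) = 1 - w"
proof -
  have "((1 - 2 * fps_X) * geo) oo w = (1 - 2 * w) * (geo oo w)"
    using assms by (simp add: fps_compose_mult_distrib fps_compose_sub_distrib numeral_fps_const)
  then show ?thesis using assms by (simp add: geo_mult fps_compose_sub_distrib)
qed

lemma real_poly_add: "real_poly (p + q) = real_poly p + real_poly q"
  by (simp add: poly_eq_iff coeff_map_poly)

lemma real_poly_sum: "real_poly (sum f A) = (\<Sum>x\<in>A. real_poly (f x))"
  by (induction A rule: infinite_finite_induct) (simp_all add: real_poly_add)

lemma real_poly_mult: "real_poly (p * q) = real_poly p * real_poly q"
  by (simp add: poly_eq_iff coeff_map_poly coeff_mult)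

lemma poly_fan_poly:
  "poly (real_poly (fan_poly n)) z = (if n = 0 then 1
     else \<Sum>i = 0..(n - 1) div 2. 2 ^ (n - 2 * i - 1) * of_int (ballot n i) * z ^ i)"
  by (simp add: fan_poly_def real_poly_sum map_poly_monom poly_sum poly_monom)

text \<open>Only the powers \<open>w\<^sup>j\<close> with \<open>j = n - 2 i\<close> have a nonzero coefficient at \<open>X\<^sup>n\<close>; reindexing by \<open>i\<close> turns the
  coefficient of a composition with \<open>geo\<close> into the shape of \<open>fan_poly\<close>.\<close>

lemma geo_sum_powers:
  assumes w: "w = - fps_X * (1 + fps_const k * w\<^sup>2)" and "n \<ge> 1"
  shows "(\<Sum>j = 0..n. geo $ j * (c ^ j * (w ^ j) $ n)) = 
    (\<Sum>i = 0..(n - 1) div 2. (- 1) ^ n * (2 ^ (n - 2 * i - 1) * of_int (ballot n i) * (c ^ (n - 2 * i) * k ^ i)))"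
proof -
  have w0: "(w ^ 0) $ n = 0" using assms(2) by simp
  have "(\<Sum>j = 0..n. geo $ j * (c ^ j * (w ^ j) $ n)) = (\<Sum>j\<in>{j\<in>{1..n}. even (n - j)}. geo $ j * (c ^ j * (w ^ j) $ n))"
  proof (rule sum.mono_neutral_right)
    show "\<forall>j\<in>{0..n} - {j\<in>{1..n}. even (n - j)}. geo $ j * (c ^ j * (w ^ j) $ n) = 0"
    proof
      fix j assume "j \<in> {0..n} - {j\<in>{1..n}. even (n - j)}"
      then have "j = 0 \<or> odd (n - j)" by auto
      then have "(w ^ j) $ n = 0" using w0 by (auto simp del: power_0 simp: power_nth_eq_ballot[OF w])
      then show "geo $ j * (c ^ j * (w ^ j) $ n) = 0" by simp
    qed
  qed auto
  also have "\<dots> = (\<Sum>i = 0..(n - 1) div 2. (- 1) ^ n * (2 ^ (n - 2 * i - 1) * of_int (ballot n i) * (c ^ (n - 2 * i) * k ^ i)))"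
    by (rule sum.reindex_bij_witness[of _ "\<lambda>i. n - 2 * i" "\<lambda>j. (n - j) div 2"])
      (use assms(2) in \<open>auto simp: power_nth_eq_ballot[OF w] geo_def\<close>)
  finally show ?thesis .
qed

lemma fan_poly_series:
  assumes w: "w = - fps_X * (1 + fps_const k * w\<^sup>2)"
  shows "(geo oo w) $ n = (- 1) ^ n * poly (real_poly (fan_poly n)) k"
proof (cases "n = 0")
  case False
  then have "(geo oo w) $ n = (\<Sum>j = 0..n. geo $ j * (1 ^ j * (w ^ j) $ n))"
    by (simp add: fps_compose_nth)
  with False show ?thesis
    by (subst (asm) geo_sum_powers[OF w]) (simp_all add: poly_fan_poly sum_distrib_left)
qed (simp add: geo_def poly_fan_poly)

lemma fan_poly_reversed_series:
  assumes w: "w = - fps_X * (1 + fps_const k * w\<^sup>2)" and "k \<noteq> 0"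
  shows "(geo oo (fps_const k * w)) $ n = (- k) ^ n * poly (real_poly (fan_poly n)) (1 / k)"
proof (cases "n = 0")
  case False
  then have "(geo oo (fps_const k * w)) $ n = (\<Sum>j = 0..n. geo $ j * (k ^ j * (w ^ j) $ n))"
    by (simp add: fps_compose_nth power_mult_distrib fps_const_power)
  also have "\<dots> = (- k) ^ n * poly (real_poly (fan_poly n)) (1 / k)"
  proof -
    have "k ^ (n - 2 * i) * k ^ i = k ^ n * (1 / k) ^ i" if "i \<le> (n - 1) div 2" for i
    proof -
      have "n = (n - 2 * i) + i + i" using that by linarith
      then have "k ^ n = k ^ (n - 2 * i) * k ^ i * k ^ i" by (metis power_add)
      then show ?thesis using assms(2) by (simp add: power_divide)
    qed
    then show ?thesis using False
      by (subst geo_sum_powers[OF w]) (simp_all add: poly_fan_poly sum_distrib_left power_minus[of k] mult_ac)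
  qed
  finally show ?thesis .
qed (simp add: geo_def poly_fan_poly)

section \<open>The sum over the colourings of one run\<close>

text \<open>Colour the rim vertices of a fan from left to right with \<open>k\<close> colours, weighting a maximal stretch of
  \<open>m\<close> vertices that share the colour of the hub by \<open>p m\<close> and every monochromatic edge between vertices
  of another colour by \<open>-k\<close>. With \<open>n\<close> vertices left to colour, \<open>hub_sum p k n m\<close> is the total weight
  from the current stretch onwards if this stretch consists so far of \<open>m\<close> vertices in the colour of the
  hub, and \<open>rim_sum p k n\<close> the total weight of what follows a vertex of another colour. The factor \<open>-2\<close>
  collects the \<open>k - 2\<close> colours different from both that of the hub and that of the last vertex, and the
  repetition of the last colour with weight \<open>-k\<close>.\<close>

fun hub_sum :: "(nat \<Rightarrow> real) \<Rightarrow> real \<Rightarrow> nat \<Rightarrow> nat \<Rightarrow> real"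
  and rim_sum :: "(nat \<Rightarrow> real) \<Rightarrow> real \<Rightarrow> nat \<Rightarrow> real" where
  "hub_sum p k 0 m = p m"
| "hub_sum p k (Suc n) m = hub_sum p k n (Suc m) + (k - 1) * p m * rim_sum p k n"
| "rim_sum p k 0 = 1"
| "rim_sum p k (Suc n) = hub_sum p k n 1 - 2 * rim_sum p k n"

text \<open>Sort the colourings by the number \<open>j\<close> of further vertices in the current stretch.\<close>

lemma hub_sum_eq: "hub_sum p k n m = p (m + n) + (k - 1) * (\<Sum>j<n. p (m + j) * rim_sum p k (n - Suc j))"
proof (induction n arbitrary: m)
  case (Suc n)
  show ?case by (simp add: Suc sum.lessThan_Suc_shift algebra_simps del: sum.lessThan_Suc)
qed simp

text \<open>The second identity is the one between rational functions of \<open>w\<close> that underlies \<open>hub_sum_fan_poly\<close>,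
  multiplied out. The other two distribute the denominators over the series \<open>z\<close> and \<open>p\<close> and over the
  variable \<open>x\<close>, whose multiples by them are polynomials in \<open>w\<close>.\<close>

lemma clear_denominators:
  fixes w k x z p F :: "'a :: comm_ring_1"
  shows "(1 - 2 * w) * (1 - 2 * (k * w)) * F * (z * (1 + (k + 1) * x - (k - 1) * x * p)) =
      ((1 - 2 * w) * z) * ((1 - 2 * (k * w)) * (F + (k + 1) * (x * F)) - (k - 1) * (x * F) * ((1 - 2 * (k * w)) * p))"
    and "(1 - w) * ((1 - 2 * (k * w)) * ((1 + k * w\<^sup>2) + (k + 1) * (- w)) - (k - 1) * (- w) * (1 - k * w)) =
      (1 - k * w) * (1 - 2 * w) * ((1 + k * w\<^sup>2) + (k + 1) * (- w))"
    and "((1 - 2 * (k * w)) * p) * (1 - 2 * w) * (F + (k + 1) * (x * F)) =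
      (1 - 2 * w) * (1 - 2 * (k * w)) * F * (p * (1 + (k + 1) * x))"
  by (simp_all add: algebra_simps power2_eq_square)

text \<open>If stretches in the colour of the hub are weighted by the reversed fan polynomials (up to sign), the
  total weight is the fan polynomial itself: with \<open>t = 1/k\<close> this is the defining identity of the inverse
  Kazhdan--Lusztig polynomial of the fan. The two recursions become linear equations between the
  generating functions \<open>A\<close> and \<open>U\<close> of the two kinds of totals and \<open>P\<close> of the weights. Eliminating
  \<open>U\<close> leaves \<open>A * B = P * D\<close> with \<open>B = 1 + (k + 1) X - (k - 1) X P\<close> and \<open>D = 1 + (k + 1) X\<close>, which
  determines \<open>A\<close> since \<open>B\<close> has constant term \<open>1\<close>; the series \<open>Z = (1 - w) / (1 - 2 w)\<close> satisfies the
  same equation.\<close>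

lemma hub_sum_fan_poly:
  fixes k :: real
  assumes k: "k \<noteq> 0" and p: "\<And>m. p m = (- k) ^ m * poly (real_poly (fan_poly m)) (1 / k)"
  shows "hub_sum p k n 0 = (- 1) ^ n * poly (real_poly (fan_poly n)) k"
proof -
  obtain w :: "real fps" where w: "w = - fps_X * (1 + fps_const k * w\<^sup>2)" 
    using ex_inverse_series by blast
  have w0: "w $ 0 = 0" by (subst w) simp
  define A where "A = Abs_fps (\<lambda>n. hub_sum p k n 0)"
  define U where "U = Abs_fps (rim_sum p k)"
  define P where "P = geo oo (fps_const k * w)"
  define Z where "Z = geo oo w"
  let ?k = "fps_const k"
  let ?D = "1 + (?k + 1) * fps_X" and ?B = "1 + (?k + 1) * fps_X - (?k - 1) * fps_X * P"
  have p0: "p 0 = 1" by (simp add: p poly_fan_poly)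
  have P_nth: "P $ n = p n" for n 
    using fan_poly_reversed_series[OF w k] by (simp add: P_def p)
  have "A $ n = (P * (1 + (?k - 1) * fps_X * U)) $ n" for n
  proof -
    have "P * (1 + (?k - 1) * fps_X * U) = P + (?k - 1) * (fps_X * (P * U))" by (simp add: algebra_simps)
    also have "\<dots> = P + fps_const (k - 1) * (fps_X * (P * U))" by (simp flip: fps_const_sub)
    also have "\<dots> $ n = A $ n"
    proof (cases n)
      case (Suc m)
      have "(\<Sum>j<Suc m. p j * rim_sum p k (m - j)) = (P * U) $ m"
        by (simp only: fps_mult_nth lessThan_Suc_atMost atLeast0AtMost) (simp add: P_nth U_def)
      then show ?thesis using Suc by (simp add: A_def hub_sum_eq[of p k "Suc m"] P_nth del: hub_sum.simps sum.lessThan_Suc)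
    qed (simp add: A_def P_nth)
    finally show ?thesis by simp
  qed
  then have A: "A = P * (1 + (?k - 1) * fps_X * U)" by (simp add: fps_eq_iff)
  have "(U * ?D) $ n = A $ n" for n
  proof -
    have "U * ?D = U + fps_const (k + 1) * (fps_X * U)" by (simp add: algebra_simps flip: fps_const_add)
    also have "\<dots> $ n = A $ n"
    proof (cases n)
      case (Suc m)
      then show ?thesis by (simp add: A_def U_def p0 algebra_simps)
    qed (simp add: A_def U_def p0)
    finally show ?thesis .
  qed
  then have U: "U * ?D = A" by (simp add: fps_eq_iff)
  have AB: "A * ?B = P * ?D"
  proof -
    have "A * ?D = P * (?D + (?k - 1) * fps_X * (U * ?D))" 
      unfolding A by (simp add: algebra_simps)
    then show ?thesis unfolding U by (simp add: algebra_simps)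
  qed
  have ZB: "Z * ?B = P * ?D"
  proof -
    have wz: "(1 - 2 * w) * Z = 1 - w" using geo_compose_mult[OF w0] by (simp add: Z_def)
    have wp: "(1 - 2 * (?k * w)) * P = 1 - ?k * w" using geo_compose_mult[of "?k * w"] w0 by (simp add: P_def)
    have xw: "fps_X * (1 + ?k * w\<^sup>2) = - w" using w by (metis minus_minus minus_mult_left)
    let ?F = "1 + ?k * w\<^sup>2"
    let ?m = "(1 - 2 * w) * (1 - 2 * (?k * w)) * ?F"
    have "?m * (Z * ?B) = ((1 - 2 * w) * Z) * ((1 - 2 * (?k * w)) * (?F + (?k + 1) * (fps_X * ?F))
        - (?k - 1) * (fps_X * ?F) * ((1 - 2 * (?k * w)) * P))"
      by (rule clear_denominators(1))
    also have "\<dots> = (1 - w) * ((1 - 2 * (?k * w)) * (?F + (?k + 1) * (- w)) - (?k - 1) * (- w) * (1 - ?k * w))"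
      by (simp only: wz wp xw)
    also have "\<dots> = (1 - ?k * w) * (1 - 2 * w) * (?F + (?k + 1) * (- w))"
      by (rule clear_denominators(2))
    also have "\<dots> = ((1 - 2 * (?k * w)) * P) * (1 - 2 * w) * (?F + (?k + 1) * (fps_X * ?F))"
      by (simp only: wp xw)
    also have "\<dots> = ?m * (P * ?D)"
      by (rule clear_denominators(3))
    finally have "?m * (Z * ?B) = ?m * (P * ?D)" .
    moreover have "?m $ 0 = 1" using w0 by (simp add: numeral_fps_const power2_eq_square)
    then have "?m \<noteq> 0" by force
    ultimately show ?thesis using mult_left_cancel by blast
  qed
  have "?B $ 0 = 1" by simp
  then have "?B \<noteq> 0" by force
  then have "A = Z" using AB ZB mult_right_cancel[of ?B A Z] by simp
  then have "A $ n = (geo oo w) $ n" by (simp add: Z_def)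
  then show ?thesis using fan_poly_series[OF w] by (simp add: A_def)
qed

section \<open>Words of colours\<close>

text \<open>A subgraph of a fan is encoded by one letter for each rim vertex: whether the vertex is joined to the
  hub, and whether it is joined to its predecessor on the rim.\<close>

type_synonym letter = "bool \<times> bool"

text \<open>The argument \<open>m\<close> is the length of the current run of vertices joined to the hub. A completed run is
  weighted by \<open>p\<close>, and an edge to the preceding vertex that does not lie in a run by \<open>x\<close>. Every
  vertex outside the runs closes a run, possibly one of length \<open>0\<close>; hence the use with \<open>p 0 = 1\<close>.\<close>

primrec run_product :: "(nat \<Rightarrow> 'a) \<Rightarrow> 'a \<Rightarrow> letter list \<Rightarrow> nat \<Rightarrow> 'a :: comm_semiring_1" where
  "run_product p x [] m = p m"
| "run_product p x (a # ls) m = (if fst a then run_product p x ls (Suc m)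
     else p m * (if snd a then x else 1) * run_product p x ls 0)"

text \<open>The letters of the subgraph of monochromatic edges, where \<open>c0\<close> is the colour of the hub, \<open>d\<close> that of the
  vertex preceding the list, and \<open>w\<close> lists the colours of the rim vertices.\<close>

fun recolour :: "nat \<Rightarrow> nat \<Rightarrow> letter list \<Rightarrow> nat list \<Rightarrow> letter list" where
  "recolour c0 d (a # ls) (c # w) = (fst a \<and> c = c0, snd a \<and> c = d) # recolour c0 c ls w"
| "recolour c0 d _ _ = []"

text \<open>Letters of a flat of a fan: neighbours on the rim that are both joined to the hub are joined to each
  other, and neighbours that are joined to each other are either both joined to the hub or both not. The
  flag \<open>s\<close> tells whether the vertex preceding the list is joined to the hub.\<close>

primrec fan_letters :: "bool \<Rightarrow> letter list \<Rightarrow> bool" where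
  "fan_letters s [] \<longleftrightarrow> True"
| "fan_letters s (a # ls) \<longleftrightarrow> (s \<and> fst a \<longrightarrow> snd a) \<and> (snd a \<longrightarrow> s = fst a) \<and> fan_letters (fst a) ls"

primrec word_sum :: "nat \<Rightarrow> nat \<Rightarrow> (nat list \<Rightarrow> 'a) \<Rightarrow> 'a :: comm_monoid_add" where
  "word_sum k 0 g = g []"
| "word_sum k (Suc n) g = (\<Sum>c<k. word_sum k n (\<lambda>w. g (c # w)))"

lemma word_sum_mult: "word_sum k n (\<lambda>w. x * g w) = x * word_sum k n g" for x :: "'a :: semiring_0"
  by (induction n arbitrary: g) (simp_all add: sum_distrib_left)

lemma word_sum_uminus: "word_sum k n (\<lambda>w. - g w) = - word_sum k n g" for g :: "_ \<Rightarrow> 'a :: ring_1"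
  using word_sum_mult[of k n "- 1" g] by simp

lemma sum_split_point:
  fixes h :: "nat \<Rightarrow> real"
  assumes "c0 < k" "\<And>c. c < k \<Longrightarrow> c \<noteq> c0 \<Longrightarrow> h c = y"
  shows "(\<Sum>c<k. h c) = h c0 + (real k - 1) * y"
proof -
  have "(\<Sum>c<k. h c) = h c0 + (\<Sum>c\<in>{..<k} - {c0}. h c)"
    using assms(1) by (subst sum.remove[of _ c0]) auto
  also have "(\<Sum>c\<in>{..<k} - {c0}. h c) = (\<Sum>c\<in>{..<k} - {c0}. y)"
    using assms(2) by (intro sum.cong) auto
  finally show ?thesis using assms(1) by (simp add: of_nat_diff)
qed

lemma sum_split_two:
  fixes h :: "nat \<Rightarrow> real"
  assumes "c0 < k" "d < k" "c0 \<noteq> d" "\<And>c. c < k \<Longrightarrow> c \<noteq> c0 \<Longrightarrow> c \<noteq> d \<Longrightarrow> h c = y"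
  shows "(\<Sum>c<k. h c) = h c0 + h d + (real k - 2) * y"
proof -
  have "(\<Sum>c<k. h c) = h c0 + h d + (\<Sum>c\<in>{..<k} - {c0, d}. h c)"
    using assms(1-3) sum.subset_diff[of "{c0, d}" "{..<k}" h] by simp
  also have "(\<Sum>c\<in>{..<k} - {c0, d}. h c) = (\<Sum>c\<in>{..<k} - {c0, d}. y)"
    using assms(4) by (intro sum.cong) auto
  also have "\<dots> = (real k - 2) * y"
    using assms(1-3) by (simp add: card_Diff_subset of_nat_diff)
  finally show ?thesis .
qed

text \<open>Within a run, the sum over words obeys the recursion of \<open>hub_sum\<close> and \<open>rim_sum\<close>, whose arguments do not
  mention colours: all colours other than that of the hub behave alike. The assumption on
  \<open>rest\<close> holds when no edge of the rim leaves the run: the letters after it then contribute a factor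
  \<open>R\<close> that does not depend on the last colour \<open>d\<close> of the run.\<close>

lemma run_word_sum:
  fixes p :: "nat \<Rightarrow> real"
  assumes "c0 < k" and p0: "p 0 = 1"
    and rest: "\<And>m d. d < k \<Longrightarrow>
      word_sum k (length rest) (\<lambda>w. run_product p (- real k) (recolour c0 d rest w) m) = p m * R"
    and run: "\<forall>a\<in>set run. a = (True, True)"
  shows "word_sum k (length (run @ rest)) (\<lambda>w. run_product p (- real k) (recolour c0 c0 (run @ rest) w) m)
        = hub_sum p (real k) (length run) m * R"
    and "d < k \<Longrightarrow> d \<noteq> c0 \<Longrightarrow>
      word_sum k (length (run @ rest)) (\<lambda>w. run_product p (- real k) (recolour c0 d (run @ rest) w) 0)
        = rim_sum p (real k) (length run) * R"
  using run
proof (induction run arbitrary: m d)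
  case Nil
  case 1 show ?case using rest[OF assms(1)] by simp
next
  case Nil
  case 2 then show ?case using rest[of d 0] p0 by simp
next
  case (Cons a run)
  case 1
  then have a: "a = (True, True)" and run: "\<forall>a\<in>set run. a = (True, True)" by auto
  show ?case 
    using sum_split_point[OF assms(1), where y = "p m * (rim_sum p (real k) (length run) * R)" and
      h = "\<lambda>c. word_sum k (length (run @ rest)) (\<lambda>w. run_product p (- real k) (recolour c0 c0 ((a # run) @ rest) (c # w)) m)"]
      Cons(1)[OF run] Cons(2)[OF _ _ run] 
    by (simp add: a word_sum_mult algebra_simps)
next
  case (Cons a run)
  case 2
  then have a: "a = (True, True)" and run: "\<forall>a\<in>set run. a = (True, True)" by auto
  have d: "d < k" "c0 \<noteq> d" using 2 by auto
  show ?case 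
    using sum_split_two[OF assms(1) d, where y = "rim_sum p (real k) (length run) * R" and
      h = "\<lambda>c. word_sum k (length (run @ rest)) (\<lambda>w. run_product p (- real k) (recolour c0 d ((a # run) @ rest) (c # w)) 0)"]
      Cons(1)[OF run] Cons(2)[OF _ _ run] d p0
    by (simp add: a word_sum_mult word_sum_uminus algebra_simps)
qed

lemma run_product_run:
  assumes "\<forall>a\<in>set run. fst a"
  shows "run_product p x (run @ rest) m = run_product p x rest (m + length run)"
  using assms by (induction run arbitrary: m) auto

lemma fan_letters_after_run:
  assumes "fan_letters True ls"
  obtains run rest where "ls = run @ rest" "\<forall>a\<in>set run. a = (True, True)"
    "rest = [] \<or> (\<exists>rest'. rest = (False, False) # rest' \<and> fan_letters False rest')"
proof -
  have "\<exists>run rest. ls = run @ rest \<and> (\<forall>a\<in>set run. a = (True, True)) \<and>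
    (rest = [] \<or> (\<exists>rest'. rest = (False, False) # rest' \<and> fan_letters False rest'))"
    using assms
  proof (induction ls)
    case (Cons a ls)
    show ?case
    proof (cases "fst a")
      case True
      then have a: "a = (True, True)" and "fan_letters True ls"
        using Cons.prems by (cases a; simp)+
      from Cons.IH[OF this(2)] obtain run rest where *: "ls = run @ rest"
        "\<forall>a\<in>set run. a = (True, True)"
        "rest = [] \<or> (\<exists>rest'. rest = (False, False) # rest' \<and> fan_letters False rest')"
        by blast
      show ?thesis by (rule exI[of _ "a # run"], rule exI[of _ rest]) (use * a in simp)
    next
      case False
      then show ?thesis using Cons.prems
        by (intro exI[of _ "[]"] exI[of _ "a # ls"]) (cases a; simp)
    qed
  qed auto
  then show ?thesis using that by blast
qed

text \<open>The coloured form of the defining identity at \<open>t = 1/k\<close>, for a subgraph of a fan with a given colour of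
  the hub. A vertex outside the runs contributes \<open>k\<close> if it is not joined to its predecessor and
  \<open>(k - 1) + (-k) = -1\<close> if it is, in either case \<open>k\<close> times its weight on the right-hand side; a whole
  run contributes the value computed in \<open>hub_sum_fan_poly\<close>.\<close>

lemma word_sum_run_product:
  fixes k :: nat
  defines "p \<equiv> \<lambda>m. (- real k) ^ m * poly (real_poly (fan_poly m)) (1 / real k)"
    and "p' \<equiv> \<lambda>m. (- 1 / real k) ^ m * poly (real_poly (fan_poly m)) (real k)"
  assumes "c0 < k" "d < k" "fan_letters False ls"
  shows "word_sum k (length ls) (\<lambda>w. run_product p (- real k) (recolour c0 d ls w) 0)
     = real k ^ length ls * run_product p' (- 1 / real k) ls 0"
  using assms(4,5)
proof (induction "length ls" arbitrary: ls d rule: less_induct)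
  case less
  have k: "real k \<noteq> 0" using assms(3) by simp
  have p0: "p 0 = 1" "p' 0 = 1" by (simp_all add: p_def p'_def fan_poly_def)
  let ?W = "\<lambda>d ls m. word_sum k (length ls) (\<lambda>w. run_product p (- real k) (recolour c0 d ls w) m)"
  let ?V = "\<lambda>ls. real k ^ length ls * run_product p' (- 1 / real k) ls 0"
  show ?case
  proof (cases ls)
    case Nil then show ?thesis by (simp add: p0)
  next
    case (Cons a ls')
    show ?thesis
    proof (cases "fst a")
      case False
      have IH: "?W c ls' 0 = ?V ls'" if "c < k" for c
        using less that Cons False by auto
      have "?W d ls 0 = (\<Sum>c<k. (if snd a \<and> c = d then - real k else 1) * ?V ls')"
        using Cons False IH by (simp add: word_sum_mult p0)
      also have "\<dots> = (\<Sum>c<k. (if snd a \<and> c = d then - real k else 1)) * ?V ls'"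
        by (simp add: sum_distrib_right)
      also have "(\<Sum>c<k. (if snd a \<and> c = d then - real k else 1)) = (if snd a then - 1 else real k)"
        using sum_split_point[of d k "\<lambda>c. if c = d then - real k else 1" 1] less.prems by auto
      finally show ?thesis using Cons False k by (simp add: p0)
    next
      case True
      have a: "a = (True, False)" and "fan_letters True ls'"
        using less.prems Cons True by (cases a; simp)+
      from fan_letters_after_run[OF this(2)]
      obtain run rest where ls': "ls' = run @ rest" and run: "\<forall>a\<in>set run. a = (True, True)"
        and rest: "rest = [] \<or> (\<exists>rest'. rest = (False, False) # rest' \<and> fan_letters False rest')"
        by blast
      have tail: "?W d rest m = p m * ?V rest" if "d < k" for m d
      proof -
        have "?W d rest m = p m * ?W d rest 0"
          using rest by (auto simp: word_sum_mult p0 sum_distrib_left)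
        moreover have "?W d rest 0 = ?V rest"
        proof (rule less.hyps)
          show "fan_letters False rest" using rest by auto
        qed (use that Cons ls' in simp_all)
        ultimately show ?thesis by simp
      qed
      let ?n = "length run"
      note R = run_word_sum[where p = p and k = k and R = "?V rest", OF assms(3) p0(1) tail run]
      \<comment> \<open>The first vertex of a run is not joined to its predecessor, so it behaves like a vertex
        preceded by the colour of the hub with a current stretch of length \<open>0\<close>.\<close>
      have "?W d ls 0 = hub_sum p (real k) (Suc ?n) 0 * ?V rest"
        using sum_split_point[OF assms(3), where y = "rim_sum p (real k) ?n * ?V rest" and
            h = "\<lambda>c. word_sum k (length (run @ rest)) (\<lambda>w. run_product p (- real k) (recolour c0 d (a # run @ rest) (c # w)) 0)"]
          R(1) R(2)
        by (simp add: Cons ls' a p0 algebra_simps)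
      also have "hub_sum p (real k) (Suc ?n) 0 = (- 1) ^ Suc ?n * poly (real_poly (fan_poly (Suc ?n))) (real k)"
        by (rule hub_sum_fan_poly[OF k]) (simp add: p_def)
      also have "\<dots> = real k ^ Suc ?n * p' (Suc ?n)"
        using k by (simp only: p'_def mult.assoc[symmetric] flip: power_mult_distrib) simp
      also have "\<dots> * ?V rest = ?V ls"
      proof -
        have "run_product p' (- 1 / real k) ls 0 = run_product p' (- 1 / real k) rest (Suc ?n)"
          using Cons ls' a run_product_run[of "a # run" p' "- 1 / real k" rest 0] run by force
        also have "\<dots> = p' (Suc ?n) * run_product p' (- 1 / real k) rest 0"
          using rest by (auto simp: p0)
        finally show ?thesis using Cons ls' by (simp add: power_add)
      qed
      finally show ?thesis .
    qed
  qed
qed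

text \<open>The rank of an encoded flat: a vertex that is joined to the hub or to its predecessor can be
  connected to an earlier vertex, and these connections form a spanning forest.\<close>

definition letter_rank :: "letter list \<Rightarrow> nat" where
  "letter_rank ls = length (filter (\<lambda>a. fst a \<or> snd a) ls)"

text \<open>A run of \<open>m\<close> vertices and a bridge have ranks \<open>m\<close> and \<open>1\<close>, so powers of \<open>y\<close> that are distributed over
  the factors add up to the rank.\<close>

lemma run_product_homogeneous:
  "run_product (\<lambda>m. y ^ m * poly (real_poly (q m)) z) y ls m
    = y ^ (m + letter_rank ls) * poly (real_poly (run_product q 1 ls m)) z"
proof (induction ls arbitrary: m)
  case (Cons a ls)
  have *: "poly (real_poly (q m * r)) z = poly (real_poly (q m)) z * poly (real_poly r) z" for m r
    by (simp only: real_poly_mult poly_mult)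
  show ?case
    by (cases "fst a"; cases "snd a") (simp_all add: Cons.IH * letter_rank_def power_add)
qed (simp add: letter_rank_def)

lemma degree_fan_poly: "2 * degree (fan_poly n) \<le> n - 1"
proof (cases "n = 0")
  case False
  have "degree (fan_poly n) \<le> (n - 1) div 2"
    unfolding fan_poly_def if_not_P[OF False]
    by (rule degree_sum_le) (auto intro: order.trans[OF degree_monom_le])
  then show ?thesis by linarith
qed (simp add: fan_poly_def)

lemma degree_run_product:
  "2 * degree (run_product fan_poly 1 ls m) \<le> m + letter_rank ls - 1"
proof (induction ls arbitrary: m)
  case Nil show ?case using degree_fan_poly[of m] by (simp add: letter_rank_def)
next
  case (Cons a ls)
  have "degree (fan_poly m * run_product fan_poly 1 ls 0) \<le> degree (fan_poly m) + degree (run_product fan_poly 1 ls 0)"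
    by (rule degree_mult_le)
  then show ?case
    using Cons.IH[of "Suc m"] Cons.IH[of 0] degree_fan_poly[of m]
    by (cases "fst a"; cases "snd a") (simp_all add: letter_rank_def)
qed

lemma run_product_rank_0:
  assumes "letter_rank ls = 0" shows "run_product fan_poly 1 ls 0 = 1"
  using assms by (induction ls) (simp_all add: letter_rank_def fan_poly_def split: if_splits)

section \<open>Compositions with proper colourings as colourings\<close>

text \<open>Deletion and contraction: the colourings that satisfy all constraints except possibly \<open>f u \<noteq> f v\<close>
  split into those that satisfy this one too and those with \<open>f u = f v\<close>. The latter are the colourings of
  \<open>V - {v}\<close> that satisfy the remaining constraints after \<open>v\<close> has been replaced by \<open>u\<close>. Pairs \<open>(u, u)\<close> are admitted since
  the replacement may produce them.\<close>

lemma card_avoiding_colourings_polynomial: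
  assumes "finite V" "R \<subseteq> V \<times> V"
  shows "\<exists>p :: int poly. \<forall>k. poly p (int k) =
    int (card {f \<in> V \<rightarrow>\<^sub>E {..<k}. \<forall>(u, v)\<in>R. f u \<noteq> f v})"
  using assms
proof (induction "card R" arbitrary: R V rule: less_induct)
  case less
  have finR: "finite R" using less.prems finite_subset by blast
  show ?case
  proof (cases "R = {}")
    case True
    then show ?thesis using less.prems
      by (intro exI[of _ "monom 1 (card V)"]) (simp add: poly_monom card_PiE)
  next
    case False
    then obtain u v where uv: "(u, v) \<in> R" by auto
    show ?thesis
    proof (cases "u = v")
      case True
      then have "{f \<in> V \<rightarrow>\<^sub>E {..<k}. \<forall>(u, v)\<in>R. f u \<noteq> f v} = {}" for k :: nat
        using uv by auto
      then show ?thesis by (intro exI[of _ 0]) (simp only: card.empty poly_0 of_nat_0 simp_thms)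
    next
      case False
      define R' where "R' = R - {(u, v)}"
      define V' where "V' = V - {v}"
      define \<sigma> where "\<sigma> x = (if x = v then u else x)" for x
      define R'' where "R'' = (\<lambda>(x, y). (\<sigma> x, \<sigma> y)) ` R'"
      have V: "u \<in> V" "v \<in> V" using uv less.prems by auto
      have less': "card R' < card R" unfolding R'_def by (rule card_Diff1_less[OF finR uv])
      have "card R'' \<le> card R'" unfolding R''_def by (rule card_image_le) (simp add: R'_def finR)
      with less' have less'': "card R'' < card R" by simp
      have "R' \<subseteq> V \<times> V" using less.prems(2) by (auto simp: R'_def)
      from less.hyps[OF less' less.prems(1) this]
      obtain p where p: "\<forall>k. poly p (int k) = int (card {f \<in> V \<rightarrow>\<^sub>E {..<k}. \<forall>(u, v)\<in>R'. f u \<noteq> f v})"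
        by (rule exE)
      have "finite V'" using less.prems(1) by (simp add: V'_def)
      moreover have "\<sigma> x \<in> V'" if "x \<in> V" for x
        using that False V by (simp add: V'_def \<sigma>_def)
      then have "R'' \<subseteq> V' \<times> V'"
        using \<open>R' \<subseteq> V \<times> V\<close> unfolding R''_def
        by (intro image_subsetI) (simp only: split_beta mem_Times_iff fst_conv snd_conv subset_iff)
      ultimately have "\<exists>q. \<forall>k. poly q (int k) = int (card {f \<in> V' \<rightarrow>\<^sub>E {..<k}. \<forall>(u, v)\<in>R''. f u \<noteq> f v})"
        by (rule less.hyps[OF less''])
      then obtain q where q: "\<forall>k. poly q (int k) = int (card {f \<in> V' \<rightarrow>\<^sub>E {..<k}. \<forall>(u, v)\<in>R''. f u \<noteq> f v})"
        by (rule exE)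
      have "poly (p - q) (int k) = int (card {f \<in> V \<rightarrow>\<^sub>E {..<k}. \<forall>(u, v)\<in>R. f u \<noteq> f v})" for k
      proof -
        define A where "A = {f \<in> V \<rightarrow>\<^sub>E {..<k}. \<forall>(u, v)\<in>R'. f u \<noteq> f v}"
        define B where "B = {f \<in> V' \<rightarrow>\<^sub>E {..<k}. \<forall>(u, v)\<in>R''. f u \<noteq> f v}"
        define D where "D = {f \<in> V \<rightarrow>\<^sub>E {..<k}. \<forall>(u, v)\<in>R. f u \<noteq> f v}"
        have finA: "finite A"
          unfolding A_def by (rule finite_subset[of _ "V \<rightarrow>\<^sub>E {..<k}"]) (auto intro: finite_PiE less.prems)
        have "bij_betw (\<lambda>f. restrict f V') {f \<in> A. f u = f v} B"
        proof (rule bij_betwI[where g = "\<lambda>g. g(v := g u)"])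
          show "(\<lambda>f. restrict f V') \<in> {f \<in> A. f u = f v} \<rightarrow> B"
          proof
            fix f assume f: "f \<in> {f \<in> A. f u = f v}"
            have "restrict f V' (\<sigma> x) = f x" if "x \<in> V" for x
              using f that V False by (auto simp: V'_def \<sigma>_def)
            note restrict_\<sigma> = this
            have "\<forall>(x, y)\<in>R''. restrict f V' x \<noteq> restrict f V' y"
            proof
              fix z assume "z \<in> R''"
              then obtain a b where ab: "(a, b) \<in> R'" and z: "z = (\<sigma> a, \<sigma> b)"
                unfolding R''_def by auto
              have "f a \<noteq> f b" using f ab unfolding A_def by blast
              moreover have "a \<in> V" "b \<in> V" using ab \<open>R' \<subseteq> V \<times> V\<close> by auto
              ultimately show "case z of (x, y) \<Rightarrow> restrict f V' x \<noteq> restrict f V' y"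
                unfolding z prod.case by (simp only: restrict_\<sigma>) simp
            qed
            moreover have "restrict f V' \<in> V' \<rightarrow>\<^sub>E {..<k}"
              using f by (auto simp: A_def V'_def)
            ultimately show "restrict f V' \<in> B" by (simp add: B_def)
          qed
          show "(\<lambda>g. g(v := g u)) \<in> B \<rightarrow> {f \<in> A. f u = f v}"
          proof
            fix g assume g: "g \<in> B"
            have gV: "g(v := g u) \<in> V \<rightarrow>\<^sub>E {..<k}"
              using g V False by (auto simp: B_def V'_def PiE_iff extensional_def)
            have upd: "(g(v := g u)) x = g (\<sigma> x)" for x by (simp add: \<sigma>_def)
            have "\<forall>(x, y)\<in>R'. (g(v := g u)) x \<noteq> (g(v := g u)) y"
            proof
              fix z assume "z \<in> R'"
              moreover obtain a b where z: "z = (a, b)" by (cases z)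
              ultimately have "(\<sigma> a, \<sigma> b) \<in> R''" unfolding R''_def by (auto intro: rev_image_eqI)
              then have "g (\<sigma> a) \<noteq> g (\<sigma> b)" using g unfolding B_def by blast
              then show "case z of (x, y) \<Rightarrow> (g(v := g u)) x \<noteq> (g(v := g u)) y"
                unfolding z prod.case upd .
            qed
            with gV show "g(v := g u) \<in> {f \<in> A. f u = f v}" using False by (simp add: A_def)
          qed
          show "(restrict f V')(v := restrict f V' u) = f" if "f \<in> {f \<in> A. f u = f v}" for f
            using that V False by (auto simp: A_def V'_def fun_eq_iff PiE_iff extensional_def)
          show "restrict (g(v := g u)) V' = g" if "g \<in> B" for g
            using that by (auto simp: B_def V'_def fun_eq_iff PiE_iff extensional_def)
        qed
        then have "card {f \<in> A. f u = f v} = card B" by (rule bij_betw_same_card)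
        moreover have "A = D \<union> {f \<in> A. f u = f v}" "D \<inter> {f \<in> A. f u = f v} = {}"
        proof -
          have R: "R = insert (u, v) R'" using uv by (auto simp: R'_def)
          show "A = D \<union> {f \<in> A. f u = f v}" "D \<inter> {f \<in> A. f u = f v} = {}"
            unfolding A_def D_def R by blast+
        qed
        then have "card A = card D + card {f \<in> A. f u = f v}"
          using finA by (metis card_Un_disjoint finite_Un)
        ultimately show ?thesis using p q by (simp add: A_def B_def D_def)
      qed
      then show ?thesis by (intro exI[of _ "p - q"] allI)
    qed
  qed
qed

lemma poly_chromatic_poly:
  assumes "finite_loopless G"
  shows "poly (chromatic_poly G) (int k) = int (card (proper_colourings G k))"
proof -
  define R where "R = {(u, v). \<exists>e\<in>edges G. ends G e = {u, v}}"
  have "R \<subseteq> verts G \<times> verts G" "finite (verts G)"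
    using assms by (fastforce simp: R_def finite_loopless_def)+
  from card_avoiding_colourings_polynomial[OF this(2,1)]
  obtain p where p: "\<forall>k. poly p (int k) =
      int (card {f \<in> verts G \<rightarrow>\<^sub>E {..<k}. \<forall>(u, v)\<in>R. f u \<noteq> f v})"
    by (rule exE)
  have "{f \<in> verts G \<rightarrow>\<^sub>E {..<k}. \<forall>(u, v)\<in>R. f u \<noteq> f v} = proper_colourings G k" for k
    by (auto simp: proper_colourings_def R_def)
  with p have "\<And>k. poly p (int k) = int (card (proper_colourings G k))" by simp
  then show ?thesis using chromatic_poly_eqI[of p G] by simp
qed

lemma finite_compositions:
  assumes "finite_loopless G" shows "finite (compositions G)"
proof (rule finite_subset)
  show "compositions G \<subseteq> Pow (Pow (verts G))"
    by (auto simp: compositions_def dest: partition_onD1)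
  show "finite (Pow (Pow (verts G)))" using assms by (simp add: finite_loopless_def)
qed

definition part_of :: "'v set set \<Rightarrow> 'v \<Rightarrow> 'v set" where
  "part_of C v = (THE P. P \<in> C \<and> v \<in> P)"

lemma part_of_eqI: 
  assumes "partition_on V C" "P \<in> C" "v \<in> P" shows "part_of C v = P"
  unfolding part_of_def
proof (rule the_equality)
  fix R assume "R \<in> C \<and> v \<in> R"
  then show "R = P" using assms unfolding partition_on_def disjoint_def by blast
qed (use assms in simp)

lemma part_of_mem:
  assumes "partition_on V C" "v \<in> V" shows "part_of C v \<in> C" "v \<in> part_of C v"
proof -
  obtain P where "P \<in> C" "v \<in> P" using assms by (auto simp: partition_on_def)
  then show "part_of C v \<in> C" "v \<in> part_of C v" using part_of_eqI[OF assms(1)] by auto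
qed

lemma ends_contract:
  assumes "partition_on V C" "u \<in> V" "v \<in> V"
  shows "{P \<in> C. P \<inter> {u, v} \<noteq> {}} = {part_of C u, part_of C v}"
proof -
  have "w \<in> P \<longleftrightarrow> P = part_of C w" if "P \<in> C" "w \<in> V" for P w
    using part_of_mem(2)[OF assms(1) that(2)] part_of_eqI[OF assms(1) that(1)] by blast
  then have "P \<in> C \<and> P \<inter> {u, v} \<noteq> {} \<longleftrightarrow> P = part_of C u \<or> P = part_of C v" for P
    using part_of_mem(1)[OF assms(1)] assms(2,3) by blast
  then show ?thesis by blast
qed

lemma edge_endsE:
  assumes "finite_loopless G" "e \<in> edges G"
  obtains u v where "ends G e = {u, v}" "u \<noteq> v" "u \<in> verts G" "v \<in> verts G"
proof -
  have "card (ends G e) = 2" "ends G e \<subseteq> verts G" using assms by (auto simp: finite_loopless_def)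
  then show ?thesis using that by (auto simp: card_2_iff)
qed

lemma flat_iff_part_of_eq:
  assumes "partition_on (verts G) C" "e \<in> edges G" "ends G e = {u, v}" "u \<in> verts G" "v \<in> verts G"
  shows "e \<in> flat G C \<longleftrightarrow> part_of C u = part_of C v"
proof
  assume "e \<in> flat G C"
  then obtain P where P: "P \<in> C" "u \<in> P" "v \<in> P" using assms(3) by (auto simp: flat_def)
  show "part_of C u = part_of C v" using part_of_eqI[OF assms(1) P(1)] P(2,3) by simp
next
  assume "part_of C u = part_of C v"
  then have "{u, v} \<subseteq> part_of C u"
    using part_of_mem(2)[OF assms(1,4)] part_of_mem(2)[OF assms(1,5)] by simp
  then show "e \<in> flat G C" using part_of_mem(1)[OF assms(1,4)] assms(2,3) by (auto simp: flat_def)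
qed

lemma finite_loopless_contract:
  assumes "finite_loopless G" "C \<in> compositions G"
  shows "finite_loopless (contract_comp G C)"
proof -
  have C: "partition_on (verts G) C" using assms(2) by (simp add: compositions_def)
  have "finite C" using C assms(1) by (auto simp: finite_loopless_def intro: finite_elements)
  moreover have "card {P\<in>C. P \<inter> ends G e \<noteq> {}} = 2" if e: "e \<in> edges G - flat G C" for e
  proof -
    obtain u v where uv: "ends G e = {u, v}" "u \<in> verts G" "v \<in> verts G"
      using edge_endsE[OF assms(1)] e by blast
    have "{P\<in>C. P \<inter> ends G e \<noteq> {}} = {part_of C u, part_of C v}"
      using ends_contract[OF C uv(2,3)] uv(1) by simp
    moreover have "part_of C u \<noteq> part_of C v" using flat_iff_part_of_eq[OF C _ uv] e by blast
    ultimately show ?thesis by simp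
  qed
  ultimately show ?thesis using assms(1) by (auto simp: finite_loopless_def contract_comp_def)
qed

text \<open>The colourings of \<open>G\<close> that arise from proper colourings of \<open>G/C\<close> by giving all vertices of a part its
  colour.\<close>

definition lifted_colourings :: "('v, 'e) mgraph \<Rightarrow> 'v set set \<Rightarrow> nat \<Rightarrow> ('v \<Rightarrow> nat) set" where
  "lifted_colourings G C k = {f \<in> verts G \<rightarrow>\<^sub>E {..<k}. (\<forall>P\<in>C. \<forall>u\<in>P. \<forall>v\<in>P. f u = f v) \<and>
     (\<forall>e\<in>edges G - flat G C. \<forall>u v. ends G e = {u, v} \<longrightarrow> f u \<noteq> f v)}"

lemma lifted_colouringsD:
  assumes "f \<in> lifted_colourings G C k"
  shows "f \<in> verts G \<rightarrow>\<^sub>E {..<k}"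
    and "P \<in> C \<Longrightarrow> u \<in> P \<Longrightarrow> v \<in> P \<Longrightarrow> f u = f v"
    and "e \<in> edges G \<Longrightarrow> e \<notin> flat G C \<Longrightarrow> ends G e = {u, v} \<Longrightarrow> f u \<noteq> f v"
  using assms unfolding lifted_colourings_def by blast+

text \<open>A colouring of the parts is recovered from its lift by looking at one chosen vertex of each part.\<close>

lemma card_lifted_colourings:
  assumes "finite_loopless G" "C \<in> compositions G"
  shows "card (lifted_colourings G C k) = card (proper_colourings (contract_comp G C) k)"
proof -
  have C: "partition_on (verts G) C" using assms(2) by (simp add: compositions_def)
  have ne: "(SOME u. u \<in> P) \<in> P" if "P \<in> C" for P
    using C that by (auto simp: partition_on_def some_in_eq)
  have sub: "P \<subseteq> verts G" if "P \<in> C" for P using C that by (auto simp: partition_on_def)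
  have ends_eq: "{P\<in>C. P \<inter> ends G e \<noteq> {}} = {part_of C u, part_of C v}"
    if "e \<in> edges G" "ends G e = {u, v}" "u \<in> verts G" "v \<in> verts G" for e u v
    using ends_contract[OF C that(3,4)] that(2) by simp
  have f_part: "f (SOME x. x \<in> part_of C u) = f u"
    if f: "f \<in> lifted_colourings G C k" and u: "u \<in> verts G" for f u
    by (rule lifted_colouringsD(2)[OF f part_of_mem(1)[OF C u] ne[OF part_of_mem(1)[OF C u]] part_of_mem(2)[OF C u]])
  have "bij_betw (\<lambda>f. \<lambda>P\<in>C. f (SOME u. u \<in> P)) (lifted_colourings G C k)
      (proper_colourings (contract_comp G C) k)"
  proof (rule bij_betwI[where g = "\<lambda>g. \<lambda>v\<in>verts G. g (part_of C v)"])
    show "(\<lambda>f. \<lambda>P\<in>C. f (SOME u. u \<in> P)) \<in> lifted_colourings G C k \<rightarrow>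
        proper_colourings (contract_comp G C) k"
    proof
      fix f assume f: "f \<in> lifted_colourings G C k"
      have "(\<lambda>P\<in>C. f (SOME u. u \<in> P)) P \<noteq> (\<lambda>P\<in>C. f (SOME u. u \<in> P)) Q"
        if e: "e \<in> edges G - flat G C" and PQ: "{P\<in>C. P \<inter> ends G e \<noteq> {}} = {P, Q}" for e P Q
      proof -
        obtain u v where uv: "ends G e = {u, v}" "u \<in> verts G" "v \<in> verts G"
          using edge_endsE[OF assms(1)] e by blast
        have "f u \<noteq> f v" using lifted_colouringsD(3)[OF f] e uv(1) by blast
        moreover have "{P, Q} = {part_of C u, part_of C v}" using ends_eq[OF _ uv] e PQ by auto
        ultimately show ?thesis using f_part[OF f] uv part_of_mem(1)[OF C] by (auto simp: doubleton_eq_iff)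
      qed
      moreover have "(\<lambda>P\<in>C. f (SOME u. u \<in> P)) \<in> C \<rightarrow>\<^sub>E {..<k}"
        using PiE_mem[OF lifted_colouringsD(1)[OF f]] ne sub by fastforce
      ultimately show "(\<lambda>P\<in>C. f (SOME u. u \<in> P)) \<in> proper_colourings (contract_comp G C) k"
        by (simp add: proper_colourings_def contract_comp_def)
    qed
    show "(\<lambda>g. \<lambda>v\<in>verts G. g (part_of C v)) \<in> proper_colourings (contract_comp G C) k \<rightarrow>
        lifted_colourings G C k"
    proof
      fix g assume g: "g \<in> proper_colourings (contract_comp G C) k"
      let ?f = "\<lambda>v\<in>verts G. g (part_of C v)"
      have "?f u \<noteq> ?f v" if e: "e \<in> edges G - flat G C" and uv: "ends G e = {u, v}" for e u v
      proof -
        have V: "u \<in> verts G" "v \<in> verts G" using e uv assms(1) by (auto simp: finite_loopless_def)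
        have "{P\<in>C. P \<inter> ends G e \<noteq> {}} = {part_of C u, part_of C v}" using ends_eq uv V e by blast
        then have "g (part_of C u) \<noteq> g (part_of C v)"
          using g e unfolding proper_colourings_def contract_comp_def by auto
        then show ?thesis using V by simp
      qed
      moreover have "?f \<in> verts G \<rightarrow>\<^sub>E {..<k}"
        using g part_of_mem(1)[OF C] by (auto simp: proper_colourings_def contract_comp_def)
      moreover have "?f u = ?f v" if "P \<in> C" "u \<in> P" "v \<in> P" for P u v
        using part_of_eqI[OF C that(1)] sub that by auto
      ultimately show "?f \<in> lifted_colourings G C k"
        unfolding lifted_colourings_def by (intro CollectI conjI ballI allI impI)
    qed
    show "(\<lambda>v\<in>verts G. (\<lambda>P\<in>C. f (SOME u. u \<in> P)) (part_of C v)) = f"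
      if f: "f \<in> lifted_colourings G C k" for f
    proof
      fix v
      have "f (SOME x. x \<in> part_of C v) = f v" if "v \<in> verts G"
        using f_part[OF f that] .
      moreover have "f v = undefined" if "v \<notin> verts G"
        using PiE_arb[OF lifted_colouringsD(1)[OF f] that] .
      ultimately show "(\<lambda>v\<in>verts G. (\<lambda>P\<in>C. f (SOME u. u \<in> P)) (part_of C v)) v = f v"
        using part_of_mem(1)[OF C] by simp
    qed
    show "(\<lambda>P\<in>C. (\<lambda>v\<in>verts G. g (part_of C v)) (SOME u. u \<in> P)) = g"
      if g: "g \<in> proper_colourings (contract_comp G C) k" for g
    proof
      fix P
      have "part_of C (SOME u. u \<in> P) = P" "(SOME u. u \<in> P) \<in> verts G" if "P \<in> C"
        using part_of_eqI[OF C that ne[OF that]] sub[OF that] ne[OF that] by auto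
      moreover have "g P = undefined" if "P \<notin> C"
        using g that PiE_arb[of g C "\<lambda>_. {..<k}" P] by (simp add: proper_colourings_def contract_comp_def)
      ultimately show "(\<lambda>P\<in>C. (\<lambda>v\<in>verts G. g (part_of C v)) (SOME u. u \<in> P)) P = g P"
        by simp
    qed
  qed
  then show ?thesis by (rule bij_betw_same_card)
qed

abbreviation reachable :: "('v, 'e) mgraph \<Rightarrow> 'v rel" where
  "reachable G \<equiv> {(u, v). u \<in> verts G \<and> v \<in> verts G \<and> (u, v) \<in> (adj G)\<^sup>*}"

lemma sym_adj: "sym (adj G)"
  by (auto simp: sym_def adj_def insert_commute)

lemma equiv_reachable: "equiv (verts G) (reachable G)"
  using sym_rtrancl[OF sym_adj, of G]
  by (auto simp: equiv_def refl_on_def sym_def trans_def dest: rtrancl_trans)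

text \<open>The parts of a composition are connected by edges of its flat, and no edge of the flat leaves a part.\<close>

lemma components_flat:
  assumes "finite_loopless G" "C \<in> compositions G"
  shows "components (G\<lparr>edges := flat G C\<rparr>) = C"
proof -
  let ?H = "G\<lparr>edges := flat G C\<rparr>"
  have C: "partition_on (verts G) C" using assms(2) by (simp add: compositions_def)
  have class_of: "reachable ?H `` {u} = P" if P: "P \<in> C" "u \<in> P" for P u
  proof -
    have "v \<in> P" if "(u, v) \<in> (adj ?H)\<^sup>*" for v
      using that
    proof induction
      case (step v w)
      then obtain e R where "R \<in> C" "{v, w} \<subseteq> R" by (auto simp: adj_def flat_def)
      with step P(1) C show ?case by (auto simp: partition_on_def disjoint_def)
    qed (use P in simp)
    moreover have "(u, v) \<in> (adj ?H)\<^sup>*" if "v \<in> P" for v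
    proof -
      have "adj (induced G P) \<subseteq> adj ?H" using P by (auto simp: adj_def induced_def flat_def)
      moreover have "(u, v) \<in> (adj (induced G P))\<^sup>*"
        using assms(2) P that by (auto simp: compositions_def connected_graph_def induced_def)
      ultimately show ?thesis using rtrancl_mono by blast
    qed
    moreover have "P \<subseteq> verts G" using C P by (auto simp: partition_on_def)
    ultimately show ?thesis using P by auto
  qed
  show ?thesis
  proof
    show "components ?H \<subseteq> C"
    proof
      fix X assume "X \<in> components ?H"
      then obtain u where u: "u \<in> verts G" "X = reachable ?H `` {u}"
        by (auto simp: components_def quotient_def)
      then have "X = part_of C u" using class_of part_of_mem[OF C u(1)] by blast
      then show "X \<in> C" using part_of_mem(1)[OF C u(1)] by simp
    qed
    show "C \<subseteq> components ?H"
    proof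
      fix P assume P: "P \<in> C"
      have "P \<noteq> {}" "P \<subseteq> verts G" using C P by (auto simp: partition_on_def)
      then obtain u where u: "u \<in> P" "u \<in> verts G" by auto
      have "reachable ?H `` {u} \<in> verts ?H // reachable ?H" using u(2) by (intro quotientI) simp
      then show "P \<in> components ?H" using class_of[OF P u(1)] by (simp only: components_def)
    qed
  qed
qed

definition monochromatic :: "('v, 'e) mgraph \<Rightarrow> ('v \<Rightarrow> nat) \<Rightarrow> 'e set" where
  "monochromatic G f = {e \<in> edges G. \<forall>u\<in>ends G e. \<forall>v\<in>ends G e. f u = f v}"

abbreviation colour_classes :: "('v, 'e) mgraph \<Rightarrow> ('v \<Rightarrow> nat) \<Rightarrow> 'v set set" where
  "colour_classes G f \<equiv> components (G\<lparr>edges := monochromatic G f\<rparr>)"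

lemma flat_lifted:
  assumes "finite_loopless G" "f \<in> lifted_colourings G C k"
  shows "flat G C = monochromatic G f"
proof
  show "flat G C \<subseteq> monochromatic G f"
    using lifted_colouringsD(2)[OF assms(2)] unfolding flat_def monochromatic_def by blast
  show "monochromatic G f \<subseteq> flat G C"
  proof
    fix e assume e: "e \<in> monochromatic G f"
    then have "e \<in> edges G" by (simp add: monochromatic_def)
    then obtain u v where "ends G e = {u, v}" by (rule edge_endsE[OF assms(1)])
    then show "e \<in> flat G C"
      using lifted_colouringsD(3)[OF assms(2)] e by (auto simp: monochromatic_def)
  qed
qed

text \<open>Every colouring is the lift of a proper colouring of \<open>G/C\<close>, where \<open>C\<close> consists of its monochromatic
  components.\<close>

lemma colour_classes_lifted:
  assumes "finite_loopless G" "f \<in> verts G \<rightarrow>\<^sub>E {..<k}"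
  shows "colour_classes G f \<in> compositions G" "f \<in> lifted_colourings G (colour_classes G f) k"
proof -
  let ?H = "G\<lparr>edges := monochromatic G f\<rparr>"
  let ?C = "colour_classes G f"
  have partition: "partition_on (verts G) ?C"
    unfolding components_def using partition_on_quotient[OF equiv_reachable[of ?H]] by simp
  have const: "f u = f v" if "(u, v) \<in> (adj ?H)\<^sup>*" for u v
    using that by induction (auto simp: adj_def monochromatic_def)
  have closed: "v \<in> verts G" if "(u, v) \<in> (adj ?H)\<^sup>*" "u \<in> verts G" for u v
    using that by induction (use assms(1) in \<open>auto simp: adj_def monochromatic_def finite_loopless_def\<close>)
  have cls: "(u, v) \<in> (adj ?H)\<^sup>*" if P: "P \<in> ?C" and "u \<in> P" "v \<in> P" for P u v
  proof -
    have "(u, v) \<in> reachable ?H"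
      using in_quotient_imp_in_rel[OF equiv_reachable[of ?H], of P u v] that by (simp add: components_def)
    then show ?thesis by simp
  qed
  have con: "connected_graph (induced G P)" if P: "P \<in> ?C" for P
  proof -
    obtain a where a: "a \<in> verts G" "P = reachable ?H `` {a}"
      using P by (auto simp: components_def quotient_def)
    have aP: "a \<in> P" using a by auto
    have "(u, v) \<in> (adj (induced G P))\<^sup>*" if uv: "u \<in> P" "v \<in> P" for u v
      \<comment> \<open>A monochromatic path between two vertices of \<open>P\<close> stays inside \<open>P\<close>.\<close>
      using cls[OF P uv]
    proof induction
      case (step y z)
      have "(a, u) \<in> (adj ?H)\<^sup>*" using cls[OF P aP uv(1)] .
      then have "(a, y) \<in> (adj ?H)\<^sup>*" using step(1) by (rule rtrancl_trans)
      moreover from this have "(a, z) \<in> (adj ?H)\<^sup>*" using step(2) by (rule rtrancl_into_rtrancl)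
      ultimately have "y \<in> P" "z \<in> P" using closed a by auto
      then have "(y, z) \<in> adj (induced G P)"
        using step(2) by (auto simp: adj_def induced_def monochromatic_def)
      with step.IH show ?case by (rule rtrancl_into_rtrancl)
    qed simp
    then show ?thesis using aP by (auto simp: connected_graph_def induced_def)
  qed
  show C: "?C \<in> compositions G" using partition con by (simp add: compositions_def)
  have "f u \<noteq> f v" if e: "e \<in> edges G - flat G ?C" "ends G e = {u, v}" for e u v
  proof
    assume "f u = f v"
    then have "e \<in> monochromatic G f" using e by (auto simp: monochromatic_def)
    then have "(u, v) \<in> (adj ?H)\<^sup>*" using e by (auto simp: adj_def)
    moreover have V: "u \<in> verts G" "v \<in> verts G" using e assms(1) by (auto simp: finite_loopless_def)
    ultimately have "{u, v} \<subseteq> reachable ?H `` {u}" by auto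
    moreover have "reachable ?H `` {u} \<in> ?C" using V by (auto simp: components_def quotient_def)
    ultimately have "e \<in> flat G ?C" using e unfolding flat_def by blast
    then show False using e by simp
  qed
  then show "f \<in> lifted_colourings G ?C k"
    using assms(2) cls const unfolding lifted_colourings_def by blast
qed

lemma lifted_colourings_eq:
  assumes "finite_loopless G" "C \<in> compositions G"
  shows "lifted_colourings G C k = {f \<in> verts G \<rightarrow>\<^sub>E {..<k}. colour_classes G f = C}"
proof -
  have "colour_classes G f = C" if "f \<in> lifted_colourings G C k" for f
    using components_flat[OF assms] flat_lifted[OF assms(1) that] by simp
  moreover have "f \<in> verts G \<rightarrow>\<^sub>E {..<k}" if "f \<in> lifted_colourings G C k" for f
    using lifted_colouringsD(1)[OF that] .
  ultimately show ?thesis using colour_classes_lifted(2)[OF assms(1)] by blast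
qed

lemma poly_real_poly_of_int: "poly (real_poly p) (of_int x) = of_int (poly p x)"
  by (induction p) (simp_all add: map_poly_pCons)

text \<open>The value \<open>\<chi>(k)\<close> for \<open>G/C\<close> counts the colourings of \<open>G\<close> whose monochromatic components form \<open>C\<close>, so the
  sum over compositions is a sum over colourings that has been grouped.\<close>

lemma sum_compositions_eq_sum_colourings:
  fixes h :: "'v set set \<Rightarrow> real" and G :: "('v, 'e) mgraph"
  assumes "finite_loopless G"
  shows "(\<Sum>C\<in>compositions G. h C * poly (real_poly (chromatic_poly (contract_comp G C))) (real k))
    = (\<Sum>f\<in>verts G \<rightarrow>\<^sub>E {..<k}. h (colour_classes G f))"
proof -
  let ?F = "verts G \<rightarrow>\<^sub>E {..<k}"
  have "(\<Sum>f\<in>?F. h (colour_classes G f)) =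
      (\<Sum>C\<in>compositions G. \<Sum>f\<in>{f \<in> ?F. colour_classes G f = C}. h (colour_classes G f))"
  proof (rule sum.group[symmetric])
    show "finite ?F" using assms by (simp add: finite_loopless_def finite_PiE)
    show "colour_classes G ` ?F \<subseteq> compositions G" using colour_classes_lifted(1)[OF assms] by blast
  qed (rule finite_compositions[OF assms])
  also have "\<dots> = (\<Sum>C\<in>compositions G. h C * poly (real_poly (chromatic_poly (contract_comp G C))) (real k))"
  proof (rule sum.cong)
    fix C assume C: "C \<in> compositions G"
    have "poly (real_poly (chromatic_poly (contract_comp G C))) (real k) = real (card (lifted_colourings G C k))"
      using poly_chromatic_poly[OF finite_loopless_contract[OF assms C], of k]
        poly_real_poly_of_int[of _ "int k"] card_lifted_colourings[OF assms C, of k] by simp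
    then show "(\<Sum>f\<in>{f \<in> ?F. colour_classes G f = C}. h (colour_classes G f)) =
        h C * poly (real_poly (chromatic_poly (contract_comp G C))) (real k)"
      by (simp add: lifted_colourings_eq[OF assms C])
  qed simp
  finally show ?thesis by simp
qed

section \<open>Laurent polynomials as functions\<close>

definition laurent :: "(real \<Rightarrow> real) \<Rightarrow> bool" where
  "laurent F \<longleftrightarrow> (\<exists>M p. \<forall>t. t \<noteq> 0 \<longrightarrow> t ^ M * F t = poly p t)"

lemma laurent_poly: "laurent (poly p)"
  unfolding laurent_def by (rule exI[of _ 0]) auto

lemma laurent_mult:
  assumes "laurent F" "laurent G" shows "laurent (\<lambda>t. F t * G t)"
proof -
  obtain M p N q where "\<And>t. t \<noteq> 0 \<Longrightarrow> t ^ M * F t = poly p t" "\<And>t. t \<noteq> 0 \<Longrightarrow> t ^ N * G t = poly q t"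
    using assms by (auto simp: laurent_def)
  then have "t ^ (M + N) * (F t * G t) = poly (p * q) t" if "t \<noteq> 0" for t
    using that by (metis mult.assoc mult.left_commute poly_mult power_add)
  then show ?thesis unfolding laurent_def by blast
qed

lemma laurent_add:
  assumes "laurent F" "laurent G" shows "laurent (\<lambda>t. F t + G t)"
proof -
  obtain M p N q where *: "\<And>t. t \<noteq> 0 \<Longrightarrow> t ^ M * F t = poly p t" "\<And>t. t \<noteq> 0 \<Longrightarrow> t ^ N * G t = poly q t"
    using assms by (auto simp: laurent_def)
  have "t ^ (M + N) * (F t + G t) = poly (monom 1 N * p + monom 1 M * q) t" if "t \<noteq> 0" for t
    by (simp add: poly_monom power_add algebra_simps flip: *[OF that])
  then show ?thesis unfolding laurent_def by blast
qed

lemma laurent_const: "laurent (\<lambda>t. c)"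
proof -
  have "poly [:c:] = (\<lambda>t. c)" by (simp add: fun_eq_iff)
  then show ?thesis using laurent_poly[of "[:c:]"] by simp
qed

lemma laurent_power: "laurent (\<lambda>t. t ^ n)"
proof -
  have "poly (monom 1 n) = (\<lambda>t :: real. t ^ n)" by (simp add: fun_eq_iff poly_monom)
  then show ?thesis using laurent_poly[of "monom 1 n"] by simp
qed

lemma laurent_sum:
  assumes "\<And>x. x \<in> A \<Longrightarrow> laurent (F x)" shows "laurent (\<lambda>t. \<Sum>x\<in>A. F x t)"
  using assms by (induction A rule: infinite_finite_induct) (auto intro: laurent_add laurent_const)

lemma laurent_poly_inverse: "laurent (\<lambda>t. poly p (1 / t))"
proof -
  have "t ^ degree p * poly p (1 / t) = poly (reflect_poly p) t" if "t \<noteq> 0" for t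
    using that by (simp add: poly_reflect_poly_nz inverse_eq_divide)
  then show ?thesis unfolding laurent_def by blast
qed

lemma laurent_eq_0:
  assumes "laurent F" "\<And>k::nat. k \<ge> 1 \<Longrightarrow> F (1 / real k) = 0" "t \<noteq> 0"
  shows "F t = 0"
proof -
  obtain M p where p: "\<And>t. t \<noteq> 0 \<Longrightarrow> t ^ M * F t = poly p t"
    using assms(1) by (auto simp: laurent_def)
  have "(\<lambda>k. 1 / real (Suc k)) ` UNIV \<subseteq> {x. poly p x = 0}"
    using p[of "1 / real (Suc _)"] assms(2)[of "Suc _"] by auto
  moreover have "infinite (range (\<lambda>k. 1 / real (Suc k)))"
    by (rule range_inj_infinite) (auto simp: inj_def)
  ultimately have "p = 0" using poly_roots_finite finite_subset by blast
  then show ?thesis using p[OF assms(3)] assms(3) by simp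
qed

section \<open>Uniqueness on a class of graphs, and the number of components\<close>

text \<open>The recursion for a graph \<open>G\<close> only visits the graphs $G[C]$, so it is enough to know the defining
  conditions on a class that is closed under this operation.\<close>

lemma inverse_KL_eqI:
  fixes Q :: "('v, 'e) mgraph \<Rightarrow> int poly"
  assumes Q: "\<And>H. K H \<Longrightarrow> inverse_KL_conditions Q H"
    and fl: "\<And>H. K H \<Longrightarrow> finite_loopless H"
    and closed: "\<And>H C. K H \<Longrightarrow> C \<in> compositions H \<Longrightarrow> K (restrict_comp H C)"
    and "K G"
  shows "inverse_KL G = Q G"
  using assms(4)
proof (induction "card (verts G) + card (edges G)" arbitrary: G rule: less_induct)
  case less
  note G = fl[OF less.prems]
  have eq: "inverse_KL_conditions (\<lambda>H. if H = G then q else inverse_KL H) G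
      = inverse_KL_conditions (Q(G := q)) G" for q
  proof (rule inverse_KL_conditions_cong)
    fix C assume C: "C \<in> compositions G"
    show "(if restrict_comp G C = G then q else inverse_KL (restrict_comp G C)) =
        (Q(G := q)) (restrict_comp G C)"
      using less.hyps[OF _ closed[OF less.prems C]] restrict_comp_smaller[OF G] by auto
  qed auto
  have "inverse_KL_conditions (Q(G := Q G)) G" using Q[OF less.prems] by simp
  then have "(THE q. inverse_KL_conditions (Q(G := q)) G) = Q G"
    using inverse_KL_conditions_unique[OF G] by blast
  then show ?case using G by (subst inverse_KL.simps) (simp add: eq)
qed

text \<open>A map \<open>r\<close> that is constant along edges and sends each vertex into its own component picks one
  representative from each component.\<close>

lemma card_components:
  assumes "finite (verts G)" and "adj G \<subseteq> verts G \<times> verts G"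
    and root: "\<And>v. v \<in> verts G \<Longrightarrow> (v, r v) \<in> (adj G)\<^sup>*"
    and inv: "\<And>u v. (u, v) \<in> adj G \<Longrightarrow> r u = r v"
  shows "card (components G) = card (r ` verts G)"
proof -
  have closed: "v \<in> verts G" if "(u, v) \<in> (adj G)\<^sup>*" "u \<in> verts G" for u v
    using that by induction (use assms(2) in auto)
  have inv': "r u = r v" if "(u, v) \<in> (adj G)\<^sup>*" for u v
    using that by induction (auto dest: inv)
  have "components G = (\<lambda>x. reachable G `` {x}) ` verts G"
    by (auto simp: components_def quotient_def)
  also have "\<dots> = (\<lambda>x. reachable G `` {x}) ` (r ` verts G)"
  proof -
    have "reachable G `` {v} = reachable G `` {r v}" if "v \<in> verts G" for v
      using equiv_class_eq[OF equiv_reachable[of G], of v "r v"] root[OF that] closed[OF root] that by auto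
    moreover have "r v \<in> verts G" if "v \<in> verts G" for v using closed[OF root] that by auto
    ultimately show ?thesis by (auto simp: image_image)
  qed
  also have "card \<dots> = card (r ` verts G)"
  proof (rule card_image, rule inj_onI)
    fix x y assume x: "x \<in> r ` verts G" and y: "y \<in> r ` verts G"
      and eq: "reachable G `` {x} = reachable G `` {y}"
    have *: "r z = z \<and> z \<in> verts G" if "z \<in> r ` verts G" for z
      using that inv'[OF root] closed[OF root] by fastforce
    have "y \<in> verts G" using *[OF y] by blast
    then have "y \<in> reachable G `` {y}" by simp
    then have "y \<in> reachable G `` {x}" by (simp only: eq)
    then have "(x, y) \<in> (adj G)\<^sup>*" by simp
    from inv'[OF this] show "x = y" using *[OF x] *[OF y] by simp
  qed
  finally show ?thesis .
qed

section \<open>Flats of fans\<close>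

definition letter :: "nat set set \<Rightarrow> nat \<Rightarrow> letter" where
  \<comment> \<open>The guard excludes \<open>i = 1\<close>, whose predecessor on the rim would be the hub.\<close>
  "letter E i = ({0, i} \<in> E, i > 1 \<and> {i - 1, i} \<in> E)"

definition letters :: "nat \<Rightarrow> nat set set \<Rightarrow> letter list" where
  "letters n E = map (letter E) [Suc 0..<Suc n]"

text \<open>For edge sets of subgraphs of a fan: no triangle with vertices \<open>0\<close>, \<open>i\<close>, \<open>i + 1\<close> has exactly two of its
  edges in \<open>E\<close>.\<close>

definition triangle_closed :: "nat set set \<Rightarrow> bool" where
  "triangle_closed E \<longleftrightarrow> (\<forall>i \<ge> 1. ({0, i} \<in> E \<and> {0, Suc i} \<in> E \<longrightarrow> {i, Suc i} \<in> E) \<and>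
     ({i, Suc i} \<in> E \<longrightarrow> ({0, i} \<in> E \<longleftrightarrow> {0, Suc i} \<in> E)))"

lemma triangle_closedD:
  assumes "triangle_closed E" "i \<ge> 1"
  shows "{0, i} \<in> E \<Longrightarrow> {0, Suc i} \<in> E \<Longrightarrow> {i, Suc i} \<in> E"
    and "{i, Suc i} \<in> E \<Longrightarrow> {0, i} \<in> E \<longleftrightarrow> {0, Suc i} \<in> E"
  using assms(1)[unfolded triangle_closed_def, THEN spec, THEN mp, OF assms(2)] by simp_all

text \<open>A class of graphs that contains \<open>fan n\<close> and is closed under passing to flats. The vertex set is
  only bounded, not prescribed, since $G[C]$ discards vertices while a colouring of \<open>G\<close> does not.\<close>

definition fan_class :: "nat \<Rightarrow> (nat, nat set) mgraph \<Rightarrow> bool" where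
  "fan_class n H \<longleftrightarrow> finite_loopless H \<and> ends H = (\<lambda>e. e) \<and> verts H \<subseteq> {0..n} \<and>
     edges H \<subseteq> edges (fan n) \<and> triangle_closed (edges H)"

lemma fan_letters_map:
  "fan_letters (fst (L a)) (map L [Suc a..<Suc a + m]) \<longleftrightarrow>
    (\<forall>i\<in>{a..<a + m}. (fst (L i) \<and> fst (L (Suc i)) \<longrightarrow> snd (L (Suc i))) \<and>
      (snd (L (Suc i)) \<longrightarrow> fst (L i) = fst (L (Suc i))))"
proof (induction m arbitrary: a)
  case (Suc m)
  have u: "[Suc a..<Suc a + Suc m] = Suc a # [Suc (Suc a)..<Suc (Suc a) + m]"
    by (simp add: upt_conv_Cons del: upt_Suc)
  have "{a..<a + Suc m} = insert a {Suc a..<Suc a + m}" by auto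
  then show ?case unfolding u list.map fan_letters.simps Suc.IH by simp
qed simp

lemma fan_class_ends:
  assumes "fan_class n H" "e \<in> edges H" shows "e \<subseteq> verts H" "card e = 2"
proof -
  have "\<forall>e\<in>edges H. ends H e \<subseteq> verts H \<and> card (ends H e) = 2" and ends: "ends H = (\<lambda>e. e)"
    using assms(1) unfolding fan_class_def finite_loopless_def by blast+
  from this(1)[unfolded ends, rule_format, OF assms(2)] have "e \<subseteq> verts H \<and> card e = 2" .
  then show "e \<subseteq> verts H" "card e = 2" by simp_all
qed

lemma fan_letters_letters:
  assumes "fan_class n H" shows "fan_letters False (letters n (edges H))"
proof -
  have "{0} \<notin> edges H" using fan_class_ends(2)[OF assms, of "{0}"] by auto
  then have 0: "fst (letter (edges H) 0) = False" by (simp add: letter_def)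
  have "(fst (letter (edges H) i) \<and> fst (letter (edges H) (Suc i)) \<longrightarrow> snd (letter (edges H) (Suc i))) \<and>
      (snd (letter (edges H) (Suc i)) \<longrightarrow> fst (letter (edges H) i) = fst (letter (edges H) (Suc i)))" for i
  proof (cases "i = 0")
    case False
    have "triangle_closed (edges H)" using assms by (simp add: fan_class_def)
    from triangle_closedD[OF this, of i] False show ?thesis by (simp add: letter_def)
  qed (use 0 in \<open>simp add: letter_def\<close>)
  then have "fan_letters (fst (letter (edges H) 0)) (map (letter (edges H)) [Suc 0..<Suc 0 + n])"
    unfolding fan_letters_map by blast
  then show ?thesis by (simp only: 0 letters_def add_Suc add_0)
qed

lemma recolour_map:
  "recolour c0 (f a) (map L [Suc a..<Suc a + m]) (map f [Suc a..<Suc a + m])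
    = map (\<lambda>i. (fst (L i) \<and> f i = c0, snd (L i) \<and> f i = f (i - 1))) [Suc a..<Suc a + m]"
proof (induction m arbitrary: a)
  case (Suc m)
  have u: "[Suc a..<Suc a + Suc m] = Suc a # [Suc (Suc a)..<Suc (Suc a) + m]"
    by (simp add: upt_conv_Cons del: upt_Suc)
  show ?case unfolding u list.map recolour.simps Suc.IH by simp
qed simp

text \<open>The colour \<open>f 0\<close> in the role of the predecessor of the first rim vertex is arbitrary, since the first
  letter never records an edge to a predecessor.\<close>

lemma letters_monochromatic:
  assumes "fan_class n H"
  shows "letters n (monochromatic H f) = recolour (f 0) (f 0) (letters n (edges H)) (map f [Suc 0..<Suc n])"
proof -
  have ends: "ends H = (\<lambda>e. e)" using assms by (simp add: fan_class_def)
  have "recolour (f 0) (f 0) (letters n (edges H)) (map f [Suc 0..<Suc n]) =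
    map (\<lambda>i. (fst (letter (edges H) i) \<and> f i = f 0, snd (letter (edges H) i) \<and> f i = f (i - 1))) [Suc 0..<Suc n]"
    using recolour_map[of "f 0" f 0 "letter (edges H)" n] by (simp add: letters_def del: upt_Suc)
  also have "\<dots> = letters n (monochromatic H f)"
    unfolding letters_def by (rule map_cong) (auto simp: letter_def monochromatic_def ends)
  finally show ?thesis by simp
qed

text \<open>Follow the spanning forest in which a vertex points to the hub if it is joined to it, and otherwise to
  its predecessor on the rim if it is joined to that.\<close>

primrec root :: "nat set set \<Rightarrow> nat \<Rightarrow> nat" where
  "root E 0 = 0"
| "root E (Suc i) = (if {0, Suc i} \<in> E then 0 else if i > 0 \<and> {i, Suc i} \<in> E then root E i else Suc i)"

lemma letter_rank_letters:
  "letter_rank (letters n E) = card {i \<in> {1..n}. {0, i} \<in> E \<or> (i > 1 \<and> {i - 1, i} \<in> E)}"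
proof -
  let ?P = "\<lambda>i. {0, i} \<in> E \<or> (i > 1 \<and> {i - 1, i} \<in> E)"
  have "letter_rank (letters n E) = length (filter ?P [Suc 0..<Suc n])"
    by (simp add: letter_rank_def letters_def filter_map letter_def comp_def del: upt_Suc)
  also have "\<dots> = card (set (filter ?P [Suc 0..<Suc n]))"
    by (rule distinct_card[symmetric]) simp
  also have "set (filter ?P [Suc 0..<Suc n]) = {i \<in> {1..n}. ?P i}" by auto
  finally show ?thesis .
qed

text \<open>Each component contains exactly one vertex without an outgoing edge in the spanning forest of \<open>root\<close>.
  That \<open>root\<close> is constant along an edge of the rim between two vertices is where \<open>triangle_closed\<close> is
  needed: if the second vertex points to the hub, so does the first.\<close>

lemma card_components_fan_class:
  assumes H: "fan_class n H"
  shows "card (components H) + letter_rank (letters n (edges H)) = card (verts H)"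
proof -
  let ?E = "edges H"
  let ?N = "{i \<in> {1..n}. {0, i} \<in> ?E \<or> (i > 1 \<and> {i - 1, i} \<in> ?E)}"
  let ?r = "root ?E"
  have fin: "finite (verts H)" and ends: "ends H = (\<lambda>e. e)" and sub: "verts H \<subseteq> {0..n}"
    using H by (auto simp: fan_class_def finite_loopless_def)
  have edge_verts: "u \<in> verts H" "v \<in> verts H" if "{u, v} \<in> ?E" for u v
    using fan_class_ends(1)[OF H that] by auto
  have adj_iff: "(u, v) \<in> adj H \<longleftrightarrow> {u, v} \<in> ?E" for u v by (auto simp: adj_def ends)
  have path: "(v, ?r v) \<in> (adj H)\<^sup>*" for v
  proof (induction v)
    case (Suc i)
    have "(Suc i, 0) \<in> adj H" if "{0, Suc i} \<in> ?E" using that by (simp add: adj_iff insert_commute)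
    moreover have "(Suc i, i) \<in> adj H" if "{i, Suc i} \<in> ?E" using that by (simp add: adj_iff insert_commute)
    ultimately show ?case using Suc.IH by (auto intro: converse_rtrancl_into_rtrancl)
  qed simp
  have root_0: "?r i = 0" if "{0, i} \<in> ?E" for i using that by (cases i) auto
  have root_Suc: "?r i = ?r (Suc i)" if "{i, Suc i} \<in> ?E" "i \<ge> 1" for i
  proof (cases "{0, Suc i} \<in> ?E")
    case True
    moreover have "triangle_closed ?E" using H by (simp add: fan_class_def)
    ultimately have "{0, i} \<in> ?E" using triangle_closedD(2)[OF _ that(2,1)] by blast
    then show ?thesis using True by (simp add: root_0)
  qed (use that in simp)
  have inv: "?r u = ?r v" if "(u, v) \<in> adj H" for u v
  proof -
    have uv: "{u, v} \<in> ?E" using that by (simp add: adj_iff)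
    then have "{u, v} \<in> edges (fan n)" using H by (auto simp: fan_class_def)
    then consider i where "{u, v} = {i, Suc i}" "i \<ge> 1" | i where "{u, v} = {0, i}"
      unfolding fan_def by auto
    then show ?thesis
    proof cases
      case 1
      then have "?r i = ?r (Suc i)" using uv by (intro root_Suc) simp_all
      then show ?thesis using 1(1) by (auto simp: doubleton_eq_iff)
    next
      case 2
      then have "?r i = ?r 0" using uv by (simp add: root_0)
      then show ?thesis using 2 by (auto simp: doubleton_eq_iff simp del: root.simps)
    qed
  qed
  have closed: "v \<in> verts H" if "(u, v) \<in> (adj H)\<^sup>*" "u \<in> verts H" for u v
    using that by induction (auto simp: adj_iff edge_verts)
  have N_iff: "Suc i \<in> ?N \<longleftrightarrow> {0, Suc i} \<in> ?E \<or> (i > 0 \<and> {i, Suc i} \<in> ?E)" for i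
  proof -
    have "Suc i \<le> n" if "{u, Suc i} \<in> ?E" for u
      using edge_verts(2)[OF that] sub by auto
    then show ?thesis by auto
  qed
  have not_N: "?r v \<notin> ?N" for v
  proof (induction v)
    case (Suc i)
    then show ?case using N_iff[of i] by auto
  qed simp
  have fixed: "?r v = v" if "v \<notin> ?N" for v
    using that N_iff by (cases v) auto
  have N_sub: "?N \<subseteq> verts H"
    using edge_verts(2) by blast
  have "?r ` verts H = verts H - ?N"
  proof
    show "?r ` verts H \<subseteq> verts H - ?N" using not_N closed[OF path] by blast
    show "verts H - ?N \<subseteq> ?r ` verts H"
    proof
      fix v assume "v \<in> verts H - ?N"
      then show "v \<in> ?r ` verts H" using fixed[of v] by (intro image_eqI[of _ _ v]) auto
    qed
  qed
  moreover have "adj H \<subseteq> verts H \<times> verts H"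
  proof (rule subrelI)
    fix u v assume "(u, v) \<in> adj H"
    then show "(u, v) \<in> verts H \<times> verts H" using edge_verts[of u v] by (simp add: adj_iff)
  qed
  then have "card (components H) = card (?r ` verts H)"
    by (rule card_components[OF fin _ path inv])
  ultimately have "card (components H) = card (verts H) - card ?N"
    using card_Diff_subset[OF finite_subset[OF N_sub fin] N_sub] by simp
  moreover have "card ?N \<le> card (verts H)" using N_sub fin by (rule card_mono[rotated])
  ultimately show ?thesis unfolding letter_rank_letters by linarith
qed

lemma rk_fan_class:
  assumes "fan_class n H" shows "rk H = letter_rank (letters n (edges H))"
  using card_components_fan_class[OF assms] by (simp add: rk_def)

text \<open>If two edges of a triangle lie in the flat of \<open>C\<close>, then all three vertices lie in one part of \<open>C\<close>; and the
  third edge, which is in the graph by the same property of the graph, is in the flat as well.\<close>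

lemma flat_fan_class:
  assumes H: "fan_class n H" and C: "C \<in> compositions H"
    and V: "V \<subseteq> verts H" "\<Union> (flat H C) \<subseteq> V"
  shows "fan_class n (H\<lparr>verts := V, edges := flat H C\<rparr>)"
proof -
  have ends: "ends H = (\<lambda>e. e)" and fl: "finite_loopless H" using H by (auto simp: fan_class_def)
  have P: "partition_on (verts H) C" using C by (simp add: compositions_def)
  have sub: "flat H C \<subseteq> edges H" by (auto simp: flat_def)
  have *: "{u, v} \<in> flat H C \<longleftrightarrow> {u, v} \<in> edges H \<and> part_of C u = part_of C v" for u v
    using flat_iff_part_of_eq[OF P, of "{u, v}" u v] fan_class_ends(1)[OF H, of "{u, v}"] sub 
    by (auto simp: ends)
  have "finite_loopless (H\<lparr>verts := V, edges := flat H C\<rparr>)"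
    using fl V sub finite_subset[OF V(1)] finite_subset[OF sub] ends by (auto simp: finite_loopless_def)
  moreover have "triangle_closed (edges H)" using H by (simp add: fan_class_def)
  then have "triangle_closed (flat H C)"
    unfolding triangle_closed_def * by metis
  ultimately show ?thesis using H V sub by (auto simp: fan_class_def)
qed

lemma fan_class_restrict:
  assumes "fan_class n H" "C \<in> compositions H"
  shows "fan_class n (restrict_comp H C)"
proof -
  have "restrict_comp H C = H\<lparr>verts := \<Union> (flat H C), edges := flat H C\<rparr>"
    using assms(1) by (simp add: restrict_comp_def fan_class_def)
  moreover have "\<Union> (flat H C) \<subseteq> verts H"
    using fan_class_ends(1)[OF assms(1)] by (auto simp: flat_def)
  ultimately show ?thesis using flat_fan_class[OF assms] by simp
qed

lemma fan_class_fan: "fan_class n (fan n)"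
proof -
  have *: "{0, i} \<in> edges (fan n) \<longleftrightarrow> 1 \<le> i \<and> i \<le> n" for i
    by (auto simp: fan_def doubleton_eq_iff)
  have **: "{i, Suc i} \<in> edges (fan n) \<longleftrightarrow> i < n" if "i \<ge> 1" for i
    using that by (auto simp: fan_def doubleton_eq_iff)
  have "edges (fan n) \<subseteq> Pow {0..n}" by (auto simp: fan_def)
  then have "finite (edges (fan n))" by (rule finite_subset) simp
  then have "finite_loopless (fan n)" by (auto simp: finite_loopless_def fan_def)
  moreover have "ends (fan n) = (\<lambda>e. e)" "verts (fan n) = {0..n}" by (simp_all add: fan_def)
  moreover have "triangle_closed (edges (fan n))"
    unfolding triangle_closed_def by (auto simp: * **)
  ultimately show ?thesis by (simp add: fan_class_def)
qed

section \<open>The inverse Kazhdan--Lusztig polynomials of fans\<close>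

lemma sum_PiE_insert:
  assumes "x \<notin> A" "finite A" "finite B"
  shows "(\<Sum>f\<in>insert x A \<rightarrow>\<^sub>E B. \<Phi> f) = (\<Sum>b\<in>B. \<Sum>f\<in>A \<rightarrow>\<^sub>E B. \<Phi> (f(x := b)))"
proof -
  have "(\<Sum>f\<in>insert x A \<rightarrow>\<^sub>E B. \<Phi> f) =
      (\<Sum>z\<in>B \<times> (A \<rightarrow>\<^sub>E B). \<Phi> ((\<lambda>(b, f). f(x := b)) z))"
    using inj_combinator[OF assms(1), of "\<lambda>_. B"] by (simp add: PiE_insert_eq sum.reindex)
  then show ?thesis by (simp add: sum.cartesian_product split_beta)
qed

lemma sum_PiE_marginal:
  fixes \<Phi> :: "('a \<Rightarrow> nat) \<Rightarrow> real"
  assumes "finite W" "finite V" "W \<inter> V = {}" "\<And>f g. (\<And>v. v \<in> V \<Longrightarrow> f v = g v) \<Longrightarrow> \<Phi> f = \<Phi> g"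
  shows "(\<Sum>f\<in>W \<union> V \<rightarrow>\<^sub>E {..<k}. \<Phi> f) = real k ^ card W * (\<Sum>f\<in>V \<rightarrow>\<^sub>E {..<k}. \<Phi> f)"
  using assms(1,3)
proof (induction W)
  case (insert x W)
  have "\<Phi> (f(x := b)) = \<Phi> f" for f b
    using insert.prems by (intro assms(4)) auto
  then have "(\<Sum>f\<in>insert x (W \<union> V) \<rightarrow>\<^sub>E {..<k}. \<Phi> f) = real k * (\<Sum>f\<in>W \<union> V \<rightarrow>\<^sub>E {..<k}. \<Phi> f)"
    using insert assms(2) by (subst sum_PiE_insert) auto
  then show ?case using insert by simp
qed simp

lemma sum_PiE_words:
  "(\<Sum>f\<in>{a..<a + m} \<rightarrow>\<^sub>E {..<k}. g (map f [a..<a + m])) = word_sum k m g"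
proof (induction m arbitrary: a g)
  case (Suc m)
  have u: "[a..<a + Suc m] = a # [Suc a..<Suc a + m]"
    by (simp add: upt_conv_Cons del: upt_Suc)
  have s: "{a..<a + Suc m} = insert a {Suc a..<Suc a + m}" by auto
  have "(\<Sum>f\<in>{a..<a + Suc m} \<rightarrow>\<^sub>E {..<k}. g (map f [a..<a + Suc m]))
      = (\<Sum>c<k. \<Sum>f\<in>{Suc a..<Suc a + m} \<rightarrow>\<^sub>E {..<k}. g (map (f(a := c)) [a..<a + Suc m]))"
    unfolding s by (rule sum_PiE_insert) auto
  also have "\<dots> = (\<Sum>c<k. \<Sum>f\<in>{Suc a..<Suc a + m} \<rightarrow>\<^sub>E {..<k}. g (c # map f [Suc a..<Suc a + m]))"
  proof (intro sum.cong refl)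
    fix c :: nat and f :: "nat \<Rightarrow> nat"
    have "map (f(a := c)) [a..<a + Suc m] = c # map f [Suc a..<Suc a + m]"
      unfolding u by (simp del: upt_Suc)
    then show "g (map (f(a := c)) [a..<a + Suc m]) = g (c # map f [Suc a..<Suc a + m])" by simp
  qed
  also have "\<dots> = (\<Sum>c<k. word_sum k m (\<lambda>w. g (c # w)))"
    by (intro sum.cong refl Suc.IH)
  finally show ?case by simp
qed simp

text \<open>The expected inverse Kazhdan--Lusztig polynomial of a graph in \<open>fan_class n\<close>: the product of \<open>fan_poly m\<close>
  over its maximal runs of \<open>m\<close> rim vertices joined to the hub.\<close>

definition fan_family :: "nat \<Rightarrow> (nat, nat set) mgraph \<Rightarrow> int poly" where
  "fan_family n H = run_product fan_poly 1 (letters n (edges H)) 0"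

text \<open>The sum over colourings of the vertices of \<open>H\<close> is extended to all vertices \<open>0, \<dots>, n\<close>, where each
  additional vertex contributes a factor \<open>k\<close>. Then the colour of the hub is fixed and the colours of the
  rim are read as a word.\<close>

lemma sum_colourings_fan_class:
  fixes k :: nat
  defines "p \<equiv> \<lambda>m. (- real k) ^ m * poly (real_poly (fan_poly m)) (1 / real k)"
    and "p' \<equiv> \<lambda>m. (- 1 / real k) ^ m * poly (real_poly (fan_poly m)) (real k)"
  assumes H: "fan_class n H" and k: "k \<ge> 1"
  shows "(\<Sum>f\<in>verts H \<rightarrow>\<^sub>E {..<k}. run_product p (- real k) (letters n (monochromatic H f)) 0)
    = real k ^ card (verts H) * run_product p' (- 1 / real k) (letters n (edges H)) 0"
proof -
  let ?V = "verts H" and ?ls = "letters n (edges H)"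
  let ?\<Phi> = "\<lambda>f. run_product p (- real k) (letters n (monochromatic H f)) 0"
  have fin: "finite ?V" and sub: "?V \<subseteq> {0..n}" and ends: "ends H = (\<lambda>e. e)"
    using H by (auto simp: fan_class_def finite_loopless_def)
  have local: "?\<Phi> f = ?\<Phi> g" if "\<And>v. v \<in> ?V \<Longrightarrow> f v = g v" for f g
  proof -
    have "(\<forall>u\<in>e. \<forall>v\<in>e. f u = f v) \<longleftrightarrow> (\<forall>u\<in>e. \<forall>v\<in>e. g u = g v)" if "e \<in> edges H" for e
    proof -
      have "f v = g v" if "v \<in> e" for v
        using \<open>\<And>v. v \<in> ?V \<Longrightarrow> f v = g v\<close> fan_class_ends(1)[OF H \<open>e \<in> edges H\<close>] that by blast
      then show ?thesis by (metis (no_types))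
    qed
    then have "monochromatic H f = monochromatic H g"
      unfolding monochromatic_def ends by blast
    then show ?thesis by simp
  qed
  have split: "({0..n} - ?V) \<union> ?V = {0..n}" "{0..n} = insert 0 {Suc 0..<Suc 0 + n}" using sub by auto
  have "real k ^ card ({0..n} - ?V) * (\<Sum>f\<in>?V \<rightarrow>\<^sub>E {..<k}. ?\<Phi> f) = (\<Sum>f\<in>{0..n} \<rightarrow>\<^sub>E {..<k}. ?\<Phi> f)"
  proof -
    have "(\<Sum>f\<in>({0..n} - ?V) \<union> ?V \<rightarrow>\<^sub>E {..<k}. ?\<Phi> f)
        = real k ^ card ({0..n} - ?V) * (\<Sum>f\<in>?V \<rightarrow>\<^sub>E {..<k}. ?\<Phi> f)"
    proof (rule sum_PiE_marginal)
      show "?\<Phi> f = ?\<Phi> g" if "\<And>v. v \<in> ?V \<Longrightarrow> f v = g v" for f g by (rule local[OF that])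
    qed (use fin in auto)
    then show ?thesis unfolding split(1) by simp
  qed
  also have "\<dots> = (\<Sum>c<k. \<Sum>f\<in>{Suc 0..<Suc 0 + n} \<rightarrow>\<^sub>E {..<k}. ?\<Phi> (f(0 := c)))"
    unfolding split(2) by (rule sum_PiE_insert) auto
  also have "\<dots> = (\<Sum>c<k. \<Sum>f\<in>{Suc 0..<Suc 0 + n} \<rightarrow>\<^sub>E {..<k}.
      run_product p (- real k) (recolour c c ?ls (map f [Suc 0..<Suc 0 + n])) 0)"
  proof (intro sum.cong refl)
    fix c :: nat and f :: "nat \<Rightarrow> nat"
    have "map (f(0 := c)) [Suc 0..<Suc n] = map f [Suc 0..<Suc 0 + n]" by (simp del: upt_Suc)
    then show "?\<Phi> (f(0 := c)) = run_product p (- real k) (recolour c c ?ls (map f [Suc 0..<Suc 0 + n])) 0"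
      unfolding letters_monochromatic[OF H] by simp
  qed
  also have "\<dots> = (\<Sum>c<k. word_sum k n (\<lambda>w. run_product p (- real k) (recolour c c ?ls w) 0))"
    by (intro sum.cong refl sum_PiE_words)
  also have "\<dots> = (\<Sum>c<k. real k ^ n * run_product p' (- 1 / real k) ?ls 0)"
  proof (intro sum.cong refl)
    fix c assume "c \<in> {..<k}"
    then have c: "c < k" by simp
    have len: "length ?ls = n" by (simp add: letters_def del: upt_Suc)
    show "word_sum k n (\<lambda>w. run_product p (- real k) (recolour c c ?ls w) 0) = real k ^ n * run_product p' (- 1 / real k) ?ls 0"
      using word_sum_run_product[OF c c fan_letters_letters[OF H]] unfolding len p_def p'_def .
  qed
  also have "\<dots> = real k ^ (n + 1) * run_product p' (- 1 / real k) ?ls 0" by simp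
  also have "n + 1 = card ({0..n} - ?V) + card ?V"
    using card_Diff_subset[OF fin sub] card_mono[OF _ sub] by simp
  finally show ?thesis using k by (simp add: power_add)
qed

text \<open>At \<open>t = 1/k\<close>, the contribution of a colouring whose monochromatic edges have rank \<open>r\<close> is
  \<open>(-1)\<^sup>r Q(1/k) k\<^sup>r\<^sup>-\<^sup>N\<close>, where \<open>N\<close> is the number of vertices. The powers of \<open>-k\<close> distribute over the runs
  and bridges, so \<open>sum_colourings_fan_class\<close> evaluates the sum; then \<open>laurent_eq_0\<close> passes from the
  values \<open>1/k\<close> to all \<open>t\<close>.\<close>

lemma inverse_KL_conditions_fan_family:
  assumes H: "fan_class n H"
  shows "inverse_KL_conditions (fan_family n) H"
proof -
  let ?r = "letter_rank (letters n (edges H))"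
  let ?Q = "fan_family n"
  have rk: "rk H = ?r" using rk_fan_class[OF H] .
  have fl: "finite_loopless H" using H by (simp add: fan_class_def)
  define L where "L t = (- t) ^ rk H * poly (real_poly (?Q H)) (1 / t)" for t
  define h where "h t C = (- 1) ^ rk (restrict_comp H C) * poly (real_poly (?Q (restrict_comp H C))) t * t ^ card C"
    for t :: real and C
  define R where "R t = (\<Sum>C\<in>compositions H. h t C * poly (real_poly (chromatic_poly (contract_comp H C))) (1 / t))" for t
  have "L (1 / real k) - R (1 / real k) = 0" if k: "k \<ge> 1" for k
  proof -
    let ?k = "real k" and ?V = "verts H"
    have k0: "?k \<noteq> 0" using k by simp
    define p where "p = (\<lambda>m. (- real k) ^ m * poly (real_poly (fan_poly m)) (1 / real k))"
    define p' where "p' = (\<lambda>m. (- 1 / real k) ^ m * poly (real_poly (fan_poly m)) (real k))"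
    have "R (1 / ?k) = (\<Sum>f\<in>?V \<rightarrow>\<^sub>E {..<k}. h (1 / ?k) (colour_classes H f))"
      using sum_compositions_eq_sum_colourings[OF fl] k0 by (simp add: R_def)
    also have "\<dots> = (\<Sum>f\<in>?V \<rightarrow>\<^sub>E {..<k}. (1 / ?k) ^ card ?V * run_product p (- ?k) (letters n (monochromatic H f)) 0)"
    proof (rule sum.cong)
      fix f assume f: "f \<in> ?V \<rightarrow>\<^sub>E {..<k}"
      let ?C = "colour_classes H f" and ?M = "monochromatic H f"
      let ?\<rho> = "letter_rank (letters n ?M)"
      have C: "?C \<in> compositions H" using colour_classes_lifted(1)[OF fl f] .
      have flat: "flat H ?C = ?M" using flat_lifted[OF fl colour_classes_lifted(2)[OF fl f]] .
      have edges: "edges (restrict_comp H ?C) = ?M" by (simp add: restrict_comp_def flat)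
      have "rk (restrict_comp H ?C) = ?\<rho>"
        using rk_fan_class[OF fan_class_restrict[OF H C]] by (simp add: edges)
      moreover have "card ?C + ?\<rho> = card ?V"
      proof -
        have "\<Union> (flat H ?C) \<subseteq> ?V" using fan_class_ends(1)[OF H] by (auto simp: flat_def)
        then have "fan_class n (H\<lparr>verts := ?V, edges := ?M\<rparr>)"
          using flat_fan_class[OF H C order_refl] by (simp add: flat)
        from card_components_fan_class[OF this] show ?thesis by simp
      qed
      moreover have "?Q (restrict_comp H ?C) = run_product fan_poly 1 (letters n ?M) 0"
        by (simp add: fan_family_def edges)
      moreover have "run_product p (- ?k) (letters n ?M) 0
          = (- ?k) ^ ?\<rho> * poly (real_poly (run_product fan_poly 1 (letters n ?M) 0)) (1 / ?k)"
        unfolding p_def by (subst run_product_homogeneous) simp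
      moreover have "(1 / ?k) ^ card ?V * ((- ?k) ^ ?\<rho> * q) = (- 1) ^ ?\<rho> * q * (1 / ?k) ^ card ?C" for q
      proof -
        have "(1 / ?k) ^ ?\<rho> * (- ?k) ^ ?\<rho> = (- 1) ^ ?\<rho>"
          using k0 by (simp flip: power_mult_distrib)
        moreover have "(1 / ?k) ^ card ?V = (1 / ?k) ^ card ?C * (1 / ?k) ^ ?\<rho>"
          unfolding power_add[symmetric] \<open>card ?C + ?\<rho> = card ?V\<close> ..
        then have "(1 / ?k) ^ card ?V * ((- ?k) ^ ?\<rho> * q)
            = (1 / ?k) ^ ?\<rho> * (- ?k) ^ ?\<rho> * q * (1 / ?k) ^ card ?C"
          by (simp only: mult_ac)
        ultimately show ?thesis by (simp only:)
      qed
      ultimately show "h (1 / ?k) ?C = (1 / ?k) ^ card ?V * run_product p (- ?k) (letters n ?M) 0"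
        unfolding h_def by (simp only:)
    qed simp
    also have "\<dots> = (1 / ?k) ^ card ?V * (?k ^ card ?V * run_product p' (- 1 / ?k) (letters n (edges H)) 0)"
      using sum_colourings_fan_class[OF H k] by (simp only: sum_distrib_left[symmetric] p_def p'_def)
    also have "\<dots> = run_product p' (- 1 / ?k) (letters n (edges H)) 0"
      using k0 by (simp add: power_divide)
    also have "\<dots> = L (1 / ?k)"
      unfolding p'_def by (subst run_product_homogeneous) (simp add: L_def rk fan_family_def)
    finally show ?thesis by simp
  qed
  moreover have "laurent (\<lambda>t. L t - R t)"
  proof -
    have "laurent (\<lambda>t. (- 1) ^ rk H * t ^ rk H * poly (real_poly (?Q H)) (1 / t))"
      by (intro laurent_mult laurent_const laurent_power laurent_poly_inverse)
    moreover have "L = (\<lambda>t. (- 1) ^ rk H * t ^ rk H * poly (real_poly (?Q H)) (1 / t))"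
      unfolding L_def by (rule ext) (rule arg_cong[where f = "\<lambda>x. x * _"], rule power_minus)
    ultimately have "laurent L" by simp
    moreover have "laurent R"
      unfolding R_def h_def
      by (intro laurent_sum laurent_mult laurent_const laurent_power laurent_poly laurent_poly_inverse)
    ultimately have "laurent (\<lambda>t. L t + (- 1) * R t)" by (intro laurent_add laurent_mult laurent_const)
    then show ?thesis by simp
  qed
  ultimately have "L t = R t" if "t \<noteq> 0" for t using laurent_eq_0[OF _ _ that] by force
  then have "(- t) ^ rk H * poly (real_poly (?Q H)) (1 / t) = (\<Sum>C\<in>compositions H.
      (- 1) ^ rk (restrict_comp H C) * poly (real_poly (?Q (restrict_comp H C))) t *
      (t ^ card C * poly (real_poly (chromatic_poly (contract_comp H C))) (1 / t)))" if "t \<noteq> 0" for t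
    using that by (simp only: L_def R_def h_def mult.assoc)
  moreover have "2 * degree (?Q H) < rk H" if "rk H > 0"
    using degree_run_product[of "letters n (edges H)" 0] that by (simp add: rk fan_family_def)
  then have "real (degree (?Q H)) < real (rk H) / 2" if "rk H > 0"
    using that by (fastforce simp: field_simps)
  moreover have "?Q H = 1" if "rk H = 0"
    using run_product_rank_0 that by (simp add: rk fan_family_def)
  ultimately show ?thesis unfolding inverse_KL_conditions_def by blast
qed

lemma inverse_KL_fan: "inverse_KL (fan n) = fan_poly n"
proof -
  have "inverse_KL (fan n) = fan_family n (fan n)"
  proof (rule inverse_KL_eqI[where K = "fan_class n"])
    show "finite_loopless H" if "fan_class n H" for H using that by (simp add: fan_class_def)
  qed (fact inverse_KL_conditions_fan_family fan_class_restrict fan_class_fan)+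
  moreover have "\<forall>a\<in>set (letters n (edges (fan n))). fst a"
    by (auto simp: letters_def letter_def fan_def)
  then have "fan_family n (fan n) = fan_poly n"
    using run_product_run[of "letters n (edges (fan n))" fan_poly 1 "[]" 0]
    by (simp add: fan_family_def letters_def del: upt_Suc)
  ultimately show ?thesis by simp
qed

theorem theorem1p1:
  fixes n :: nat
  assumes "n \<ge> 1"
  shows "(map_poly of_int (inverse_KL (fan n)) :: real poly) =
    (\<Sum>k = 0..(n - 1) div 2.
       monom (real (n - 2 * k) * 2 ^ (n - 2 * k - 1) / real n * real (n choose k)) k)"
proof -
  have "2 ^ (n - 2 * k - 1) * of_int (ballot n k)
      = real (n - 2 * k) * 2 ^ (n - 2 * k - 1) / real n * real (n choose k)" if "k \<le> (n - 1) div 2" for k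
  proof -
    have "real n * of_int (ballot n k) = real (n - 2 * k) * real (n choose k)"
      using that by (intro of_nat_mult_ballot) simp
    then have "of_int (ballot n k) = real (n - 2 * k) * real (n choose k) / real n"
      using assms by (simp add: eq_divide_eq mult.commute)
    then show ?thesis by simp
  qed
  note coeff = this
  have "real_poly (inverse_KL (fan n)) =
      (\<Sum>k = 0..(n - 1) div 2. monom (2 ^ (n - 2 * k - 1) * of_int (ballot n k)) k)"
    using assms by (simp add: inverse_KL_fan fan_poly_def real_poly_sum map_poly_monom)
  also have "\<dots> = (\<Sum>k = 0..(n - 1) div 2.
      monom (real (n - 2 * k) * 2 ^ (n - 2 * k - 1) / real n * real (n choose k)) k)"
    by (rule sum.cong) (simp_all only: atLeastAtMost_iff coeff)
  finally show ?thesis .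
qed

end
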